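(* Let $N\ge 2$ and let $\Gamma\subset\mathrm{U}(N)$ be a nontrivial finite fixed-point-free subgroup. Then the rational function $F_\Gamma(z,w)$ on $\mathbb{C}^N\times\mathbb{C}^N$ is not identically zero.
   Context: A finite subgroup $\Gamma\subset\mathrm{U}(N)$ is fixed-point-free if $1$ is not an eigenvalue of $\gamma$ for every $\gamma\in\Gamma\setminus\{I\}$. Points of $\mathbb{C}^N\times\mathbb{C}^N$ are written $(z,w)$ with $z,w$ column vectors, and $\mathsf{T}$ denotes transpose. For a rational function $u=u(z,w)$, let $u_z=(u_{z_i})$ and $u_w=(u_{w_j})$ be the column vectors of first derivatives and $u_{zw}=(u_{z_iw_j})$ the $N\times N$ matrix of mixed derivatives, and define $$M(u)=\begin{bmatrix}u&u_w^{\mathsf{T}}\\ u_z&u_{zw}\end{bmatrix},\qquad F(u)=\det M(u)-(N+1)^N u^{N+2}.$$ For $\gamma\in\mathrm{U}(N)$ and a finite subgroup $\Gamma\subset\mathrm{U}(N)$ define $$h_\gamma=1-z^{\mathsf{T}}\gamma w,\qquad \phi_\Gamma(z,w)=\sum_{\gamma\in\Gamma}\det(\gamma)\,h_\gamma^{-(N+1)},\qquad F_\Gamma=F(\phi_\Gamma).$$ *)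

theory Defs
  imports "HOL-Analysis.Analysis" "HOL-Algebra.Group"
begin

definition conj_transpose :: "complex^'n^'m \<Rightarrow> complex^'m^'n"
  where "conj_transpose A = (\<chi> i j. cnj (A $ j $ i))"

definition unitary_matrix :: "complex^'n^'n \<Rightarrow> bool"
  where "unitary_matrix A \<longleftrightarrow>
    conj_transpose A ** A = mat 1 \<and> A ** conj_transpose A = mat 1"

text \<open>The group $U(N)$, where $N$ is the cardinality of the index type.\<close>

definition unitary_group :: "(complex^'n^'n) monoid"
  where "unitary_group = \<lparr>carrier = {A. unitary_matrix A}, mult = (**), one = mat 1\<rparr>"

lemma conj_transpose_mult: "conj_transpose (A ** B) = conj_transpose B ** conj_transpose A"
  by (simp add: conj_transpose_def matrix_matrix_mult_def vec_eq_iff mult.commute)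

lemma conj_transpose_mat1: "conj_transpose (mat 1) = mat 1"
  by (simp add: conj_transpose_def mat_def vec_eq_iff)

lemma conj_transpose_twice: "conj_transpose (conj_transpose A) = A"
  by (simp add: conj_transpose_def vec_eq_iff)

lemma unitary_matrix_mult:
  assumes "unitary_matrix A" "unitary_matrix B"
  shows "unitary_matrix (A ** B)"
proof -
  have "conj_transpose (A ** B) ** (A ** B)
      = conj_transpose B ** (conj_transpose A ** A) ** B"
    by (simp add: conj_transpose_mult matrix_mul_assoc)
  moreover have "(A ** B) ** conj_transpose (A ** B)
      = A ** (B ** conj_transpose B) ** conj_transpose A"
    by (simp add: conj_transpose_mult matrix_mul_assoc)
  ultimately show ?thesis
    using assms by (simp add: unitary_matrix_def)
qed

lemma group_unitary_group: "group (unitary_group :: (complex^'n^'n) monoid)"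
proof (rule groupI)
  fix A :: "complex^'n^'n"
  assume "A \<in> carrier unitary_group"
  then show "\<exists>B\<in>carrier unitary_group. B \<otimes>\<^bsub>unitary_group\<^esub> A = \<one>\<^bsub>unitary_group\<^esub>"
    by (intro bexI[of _ "conj_transpose A"])
       (auto simp: unitary_group_def unitary_matrix_def conj_transpose_twice)
qed (auto simp: unitary_group_def unitary_matrix_mult matrix_mul_assoc
       unitary_matrix_def[of "mat 1"] conj_transpose_mat1)

definition matrix_eigenvalue :: "complex^'n^'n \<Rightarrow> complex \<Rightarrow> bool"
  where "matrix_eigenvalue A c \<longleftrightarrow> (\<exists>v. v \<noteq> 0 \<and> A *v v = c *s v)"

definition fixed_point_free :: "(complex^'n^'n) set \<Rightarrow> bool"
  where "fixed_point_free \<Gamma> \<longleftrightarrow> (\<forall>\<gamma> \<in> \<Gamma> - {mat 1}. \<not> matrix_eigenvalue \<gamma> 1)"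

text \<open>Rational functions of $(z,w)$ are represented by the total functions obtained from
  Isabelle's convention $x / 0 = 0$; their values and derivatives are meaningful only away
  from the poles.\<close>

definition deriv_z :: "'n \<Rightarrow> ((complex^'n) \<times> (complex^'n) \<Rightarrow> complex) \<Rightarrow> (complex^'n) \<times> (complex^'n) \<Rightarrow> complex"
  where "deriv_z i u = (\<lambda>(z, w). deriv (\<lambda>t. u (z + t *s axis i 1, w)) 0)"

definition deriv_w :: "'n \<Rightarrow> ((complex^'n) \<times> (complex^'n) \<Rightarrow> complex) \<Rightarrow> (complex^'n) \<times> (complex^'n) \<Rightarrow> complex"
  where "deriv_w j u = (\<lambda>(z, w). deriv (\<lambda>t. u (z, w + t *s axis j 1)) 0)"

text \<open>The bordered matrix has index type \<^typ>\<open>'n option\<close>: the index \<^const>\<open>None\<close> is the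
  additional first row and column.\<close>

definition M_matrix ::
    "((complex^'n) \<times> (complex^'n) \<Rightarrow> complex) \<Rightarrow> (complex^'n) \<times> (complex^'n) \<Rightarrow> complex^('n option)^('n option)"
  where "M_matrix u p = (\<chi> r c. case (r, c) of
      (None, None) \<Rightarrow> u p
    | (None, Some j) \<Rightarrow> deriv_w j u p
    | (Some i, None) \<Rightarrow> deriv_z i u p
    | (Some i, Some j) \<Rightarrow> deriv_w j (deriv_z i u) p)"

definition F_op :: "((complex^'n) \<times> (complex^'n) \<Rightarrow> complex) \<Rightarrow> (complex^'n) \<times> (complex^'n) \<Rightarrow> complex"
  where "F_op u p = det (M_matrix u p) - of_nat ((CARD('n) + 1) ^ CARD('n)) * u p ^ (CARD('n) + 2)"

definition h_fun :: "complex^'n^'n \<Rightarrow> (complex^'n) \<times> (complex^'n) \<Rightarrow> complex"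
  where "h_fun \<gamma> = (\<lambda>(z, w). 1 - scalar_product z (\<gamma> *v w))"

definition phi :: "(complex^'n^'n) set \<Rightarrow> (complex^'n) \<times> (complex^'n) \<Rightarrow> complex"
  where "phi \<Gamma> p = (\<Sum>\<gamma>\<in>\<Gamma>. det \<gamma> * inverse (h_fun \<gamma> p ^ (CARD('n) + 1)))"

definition F_group :: "(complex^'n^'n) set \<Rightarrow> (complex^'n) \<times> (complex^'n) \<Rightarrow> complex"
  where "F_group \<Gamma> = F_op (phi \<Gamma>)"

text \<open>For finite $\Gamma$ this set is open and dense (the complement of the zero set of a nonzero
  polynomial), and on it the rational functions $\phi_\Gamma$ and $F_\Gamma$ have no poles. Hence
  $F_\Gamma$ is the zero rational function iff it vanishes at every point of this set.\<close>

definition regular_points :: "(complex^'n^'n) set \<Rightarrow> ((complex^'n) \<times> (complex^'n)) set"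
  where "regular_points \<Gamma> = {p. \<forall>\<gamma>\<in>\<Gamma>. h_fun \<gamma> p \<noteq> 0}"

end

theory Submission
  imports Defs
begin

text \<open>
Let $N \ge 2$ be the number of coordinates. The function $h_1^{-(N+1)}$ is the polarized Bergman
  kernel of the unit ball up to a constant, and it satisfies $F = 0$, which expresses that the Bergman
  metric is Kaehler-Einstein. Two different reasons prevent the sum $\phi_\Gamma$ from being another
  solution.

  Suppose that $\Gamma$ contains an element $\gamma$ that is not a scalar. Along the hypersurface $h_1 = 0$
  write $\phi_\Gamma = h_1^{-(N+1)} + v$, where $v$ is regular at generic points. The perturbation $v$ has
  relative size $h_1^{N+1}$, and its linear contribution to $F$ begins one order later than expected,
  at relative order $h_1^{N+2}$. This term dominates the quadratic ones, so $F_\Gamma = 0$ forces a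
  second-order linear equation for $v$ on $h_1 = 0$ (lemma \<open>boundary_obstruction\<close>). Each
  $h_\delta^{-(N+1)}$ contributes an explicit function to it, with a pole of order $N+3$ along
  $h_\delta = 0$ and leading coefficient proportional to $z^T \delta^2 w - 1$. Fixed-point-freeness and unitarity
  imply that a generic point of $h_1 = h_\gamma = 0$ lies on no third polar hypersurface and that the
  leading coefficient for $\gamma$ is nonzero there (lemma \<open>isolated_double_zero\<close>).
  The equation is therefore violated near such a point.

  If all elements of $\Gamma$ are scalars, the hypersurfaces $h_\delta = 0$ do not meet, and the argument is
  arithmetical. Now $\phi_\Gamma = g(t)$ with $t = z^T w$, and $F_\Gamma = 0$ is an ordinary differential
  equation for $g$. If $e$ is the exponent of $\Gamma$, then $g$ is a power series in which only the
  exponents congruent to $-N$ modulo $e$ occur, with explicit positive coefficients. The two lowest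
  terms of $g$ determine the lowest terms of both sides of the equation
  (lemma \<open>fps_leading_terms\<close>). Equality would require a relation between binomial coefficients
  that a strict inequality excludes for $N \ge 2$ (lemma \<open>binomial_inequality\<close>). For $N = 1$ that
  inequality becomes an equality, in accordance with the fact that a quotient of the disc by a
  rotation group is again a disc.
\<close>

section \<open>Determinants of bordered matrices\<close>

definition outer :: "complex^'m \<Rightarrow> complex^'n \<Rightarrow> complex^'n^'m"
  where "outer c r = (\<chi> i j. c $ i * r $ j)"

text \<open>
  Written in these blocks, row and column operations on $M(u)$ become block products.
\<close>

definition bordered :: "complex \<Rightarrow> complex^'n \<Rightarrow> complex^'m \<Rightarrow> complex^'n^'m \<Rightarrow> complex^('n option)^('m option)"
  where "bordered a r c B = (\<chi> i j. case (i, j) of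
      (None, None) \<Rightarrow> a
    | (None, Some l) \<Rightarrow> r $ l
    | (Some k, None) \<Rightarrow> c $ k
    | (Some k, Some l) \<Rightarrow> B $ k $ l)"

lemma bordered_nth [simp]:
  "bordered a r c B $ None $ None = a"
  "bordered a r c B $ None $ Some l = r $ l"
  "bordered a r c B $ Some k $ None = c $ k"
  "bordered a r c B $ Some k $ Some l = B $ k $ l"
  by (simp_all add: bordered_def)

lemma mat_mult_nth [simp]: "(mat c ** A) $ i $ j = (c :: 'a::comm_semiring_1) * A $ i $ j"
  by (simp add: matrix_matrix_mult_def mat_def if_distrib if_distribR cong: if_cong)

lemma mat_nth: "mat c $ i $ j = (if i = j then c else 0)"
  by (simp add: mat_def)

lemma sum_option: "(\<Sum>x\<in>UNIV. f x) = f None + (\<Sum>i\<in>UNIV. f (Some i))"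
  for f :: "'n::finite option \<Rightarrow> 'a::comm_monoid_add"
  by (simp add: UNIV_option_conv sum.reindex)

lemma prod_option: "(\<Prod>x\<in>UNIV. f x) = f None * (\<Prod>i\<in>UNIV. f (Some i))"
  for f :: "'n::finite option \<Rightarrow> 'a::comm_monoid_mult"
  by (simp add: UNIV_option_conv prod.reindex)

lemma option_matrix_eqI:
  assumes "A $ None $ None = B $ None $ None" "\<And>l. A $ None $ Some l = B $ None $ Some l"
    "\<And>k. A $ Some k $ None = B $ Some k $ None" "\<And>k l. A $ Some k $ Some l = B $ Some k $ Some l"
  shows "A = (B :: complex^('n::finite option)^('m::finite option))"
proof -
  have "A $ i $ j = B $ i $ j" for i j
    using assms by (cases i; cases j) auto
  then show ?thesis by (simp add: vec_eq_iff)
qed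

lemma bordered_mult:
  "bordered a r c B ** bordered a' r' c' B' =
   bordered (a * a' + scalar_product r c') (a *s r' + r v* B') (a' *s c + B *v c') (outer c r' + B ** B')"
  by (rule option_matrix_eqI)
     (simp_all add: matrix_matrix_mult_def sum_option scalar_product_def outer_def
       vector_matrix_mult_def matrix_vector_mult_def mult.commute)

lemma transpose_bordered: "transpose (bordered a r c B) = bordered a c r (transpose B)"
  by (rule option_matrix_eqI) (simp_all add: transpose_def)

text \<open>
  Only the identity permutation contributes: the row \<open>Some k\<close> has its single possibly nonzero entry
  on the diagonal, which leaves \<open>None\<close> for \<open>None\<close>.
\<close>

lemma det_bordered_upper: "det (bordered a r 0 (mat d :: complex^'n^'n)) = a * d ^ CARD('n)"
proof -
  let ?A = "bordered a r 0 (mat d :: complex^'n^'n)"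
  have "(\<Prod>i\<in>UNIV. ?A $ i $ p i) = 0" if p: "p permutes UNIV" and "p \<noteq> id" for p
  proof (rule ccontr)
    assume nz: "(\<Prod>i\<in>UNIV. ?A $ i $ p i) \<noteq> 0"
    then have nz': "?A $ i $ p i \<noteq> 0" for i by auto
    have s: "p (Some k) = Some k" for k
      using nz'[of "Some k"] by (cases "p (Some k)") (auto simp: mat_def split: if_splits)
    have "p None = None"
      using s permutes_inj[OF p] by (metis injD option.distinct(1) option.exhaust)
    with s have "p = id" by (metis eq_id_iff option.exhaust)
    with that show False by simp
  qed
  then have "det ?A = (\<Sum>p\<in>{id}. of_int (sign p) * (\<Prod>i\<in>UNIV. ?A $ i $ p i))"
    unfolding det_def by (intro sum.mono_neutral_right) (auto simp: permutes_id)
  also have "\<dots> = a * d ^ CARD('n)"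
    by (simp add: prod_option mat_def sign_id)
  finally show ?thesis .
qed

lemma det_bordered_lower: "det (bordered a 0 c (mat d :: complex^'n^'n)) = a * d ^ CARD('n)"
proof -
  have "det (bordered a 0 c (mat d :: complex^'n^'n)) = det (transpose (bordered a 0 c (mat d :: complex^'n^'n)))"
    by simp
  also have "\<dots> = a * d ^ CARD('n)"
    unfolding transpose_bordered by (simp add: transpose_mat det_bordered_upper)
  finally show ?thesis .
qed

lemma mat_mult_vec [simp]: "mat (d::complex) *v v = d *s v" and vec_mult_mat [simp]: "v v* mat (d::complex) = d *s v"
  by (simp_all add: mat_def vec_eq_iff matrix_vector_mult_def vector_matrix_mult_def if_distrib if_distribR
     cong: if_cong)

lemma outer_mult_vec: "outer c r *v v = scalar_product r v *s c"
  by (simp add: outer_def vec_eq_iff matrix_vector_mult_def scalar_product_def sum_distrib_left sum_distrib_right mult_ac)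

lemma scalar_product_scale [simp]:
  "scalar_product (c *s v) w = c * scalar_product v (w :: complex^'n)"
  "scalar_product v (c *s w) = c * scalar_product v (w :: complex^'n)"
  "scalar_product (- v) w = - scalar_product v (w :: complex^'n)"
  "scalar_product v (- w) = - scalar_product v (w :: complex^'n)"
  by (simp_all add: scalar_product_def sum_distrib_left sum_negf mult_ac)

text \<open>
  The shape of $M(g(z^T w))$ for a function $g$ of one variable. A row operation with the first row
  removes the rank-one part of the large block, and a column operation then clears the first column.
\<close>

lemma det_bordered_rank_one:
  fixes z w :: "complex^'n"
  assumes "b \<noteq> 0" "d \<noteq> 0"
  shows "det (bordered a (b *s z) (b *s w) (outer (c *s w) z + mat d)) =
    d ^ (CARD('n) - 1) * (a * d - scalar_product z w * (b\<^sup>2 - c * a))"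
proof -
  let ?M = "bordered a (b *s z) (b *s w) (outer (c *s w) z + mat d)"
  define x where "x = - (c / b)"
  define e where "e = b - c * a / b"
  define y where "y = - (e / d)"
  have 1: "bordered 1 0 (x *s w) (mat 1) ** ?M = bordered a (b *s z) (e *s w) (mat d)"
    unfolding bordered_mult
    using assms by (intro option_matrix_eqI)
      (auto simp: scalar_product_def outer_def x_def e_def field_simps vector_matrix_mult_def)
  have 2: "bordered a (b *s z) (e *s w) (mat d) ** bordered 1 0 (y *s w) (mat 1) =
      bordered (a + b * y * scalar_product z w) (b *s z) 0 (mat d)"
    unfolding bordered_mult
    using assms by (intro option_matrix_eqI)
      (auto simp: outer_def y_def e_def field_simps)
  have "det ?M = det (bordered 1 0 (x *s w) (mat 1) ** ?M ** bordered 1 0 (y *s w) (mat 1))"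
    by (simp add: det_mul det_bordered_lower)
  also have "\<dots> = (a + b * y * scalar_product z w) * d ^ CARD('n)"
    unfolding 1 2 det_bordered_upper ..
  also have "d ^ CARD('n) = d * d ^ (CARD('n) - 1)"
    by (metis power_eq_if zero_less_card_finite less_numeral_extra(3))
  also have "(a + b * y * scalar_product z w) * (d * d ^ (CARD('n) - 1)) =
      d ^ (CARD('n) - 1) * (a * d - scalar_product z w * (b\<^sup>2 - c * a))"
    using assms by (simp add: y_def e_def field_simps power2_eq_square)
  finally show ?thesis .
qed

section \<open>First-order expansion of the determinant\<close>

lemma prod_first_order:
  fixes e :: "'a \<Rightarrow> complex"
  assumes "finite A" and f: "\<And>i. i \<in> A \<Longrightarrow> f i \<in> O[F](\<lambda>_. 1)" and e: "e \<in> O[F](\<lambda>_. 1)"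
  shows "(\<lambda>x. (\<Prod>i\<in>A. 1 + e x * f i x) - 1 - e x * (\<Sum>i\<in>A. f i x)) \<in> O[F](\<lambda>x. e x ^ 2)"
  using assms(1) f
proof (induction A rule: finite_induct)
  case empty
  then show ?case by simp
next
  case (insert a A)
  let ?S = "\<lambda>x. \<Sum>i\<in>A. f i x"
  let ?R = "\<lambda>x. (\<Prod>i\<in>A. 1 + e x * f i x) - 1 - e x * ?S x"
  have fa: "f a \<in> O[F](\<lambda>_. 1)" using insert by auto
  have S: "?S \<in> O[F](\<lambda>_. 1)"
    using insert by (intro big_sum_in_bigo) auto
  have R: "?R \<in> O[F](\<lambda>x. e x ^ 2)" using insert by auto
  have 1: "(\<lambda>x. e x ^ 2 * (f a x * ?S x)) \<in> O[F](\<lambda>x. e x ^ 2 * (1 * 1))"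
    by (intro landau_o.big.mult fa S landau_o.big_refl)
  have "(\<lambda>x. 1 + e x * f a x) \<in> O[F](\<lambda>_. 1)"
    using landau_o.big.mult[OF e fa] by (intro sum_in_bigo) auto
  then have 2: "(\<lambda>x. ?R x * (1 + e x * f a x)) \<in> O[F](\<lambda>x. e x ^ 2 * 1)"
    by (intro landau_o.big.mult R)
  have "(\<lambda>x. e x ^ 2 * (f a x * ?S x) + ?R x * (1 + e x * f a x)) \<in> O[F](\<lambda>x. e x ^ 2)"
    using 1 2 by (intro sum_in_bigo) simp_all
  also have "(\<lambda>x. e x ^ 2 * (f a x * ?S x) + ?R x * (1 + e x * f a x)) =
     (\<lambda>x. (\<Prod>i\<in>insert a A. 1 + e x * f i x) - 1 - e x * (\<Sum>i\<in>insert a A. f i x))"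
    using insert by (simp add: fun_eq_iff algebra_simps power2_eq_square)
  finally show ?case .
qed

text \<open>
  A permutation other than the identity moves at least two indices, so its term is of second
  order. The first-order part therefore comes from the product of the diagonal alone.
\<close>

lemma det_first_order:
  fixes Y :: "'a \<Rightarrow> complex^'m^'m"
  assumes Y: "\<And>i j. (\<lambda>x. Y x $ i $ j) \<in> O[F](\<lambda>_. 1)" and e: "e \<in> O[F](\<lambda>_. 1)"
  shows "(\<lambda>x. det (mat 1 + mat (e x) ** Y x) - 1 - e x * trace (Y x)) \<in> O[F](\<lambda>x. e x ^ 2)"
proof -
  let ?E = "\<lambda>x i j. (mat 1 + mat (e x) ** Y x) $ i $ j"
  let ?T = "\<lambda>p x. of_int (sign p) * (\<Prod>i\<in>UNIV. ?E x i (p i)) :: complex"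
  let ?P = "{p. p permutes (UNIV :: 'm set)}"
  have E: "(\<lambda>x. ?E x i j) \<in> O[F](\<lambda>_. 1)" for i j
    using landau_o.big.mult[OF e Y[of i j]] by (simp add: mat_nth sum_in_bigo)
  have off: "(\<lambda>x. ?E x i j) \<in> O[F](e)" if "i \<noteq> j" for i j
    using landau_o.big.mult[OF landau_o.big_refl[of e] Y[of i j]] that by (simp add: mat_nth)
  have nonid: "?T p \<in> O[F](\<lambda>x. e x ^ 2)" if p: "p permutes UNIV" and "p \<noteq> id" for p
  proof -
    from \<open>p \<noteq> id\<close> obtain i where i: "p i \<noteq> i" by (auto simp: fun_eq_iff)
    have j: "p (p i) \<noteq> p i" using i permutes_inj[OF p] by (auto dest: injD)
    have "(\<lambda>x. \<Prod>k\<in>UNIV - {i} - {p i}. ?E x k (p k)) \<in> O[F](\<lambda>x. \<Prod>k\<in>UNIV - {i} - {p i}. 1)"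
      by (intro landau_o.big_prod E)
    then have "(\<lambda>x. ?E x i (p i) * (?E x (p i) (p (p i)) * (\<Prod>k\<in>UNIV - {i} - {p i}. ?E x k (p k))))
        \<in> O[F](\<lambda>x. e x * (e x * 1))"
      using i j by (intro landau_o.big.mult off) auto
    also have "(\<lambda>x. ?E x i (p i) * (?E x (p i) (p (p i)) * (\<Prod>k\<in>UNIV - {i} - {p i}. ?E x k (p k))))
        = (\<lambda>x. \<Prod>k\<in>UNIV. ?E x k (p k))"
      using i by (subst (2) prod.remove[of _ i], simp, simp, subst (2) prod.remove[of _ "p i"]) auto
    finally have *: "(\<lambda>x. \<Prod>k\<in>UNIV. ?E x k (p k)) \<in> O[F](\<lambda>x. e x ^ 2)"
      by (simp add: power2_eq_square)
    show ?thesis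
      using landau_o.big.mult[OF bigo_const[of "of_int (sign p)" F] *] by simp
  qed
  have "(\<lambda>x. \<Sum>p\<in>?P - {id}. ?T p x) \<in> O[F](\<lambda>x. e x ^ 2)"
    by (intro big_sum_in_bigo nonid) auto
  moreover have "(\<lambda>x. (\<Prod>i\<in>UNIV. 1 + e x * Y x $ i $ i) - 1 - e x * (\<Sum>i\<in>UNIV. Y x $ i $ i)) \<in> O[F](\<lambda>x. e x ^ 2)"
    by (intro prod_first_order Y e) simp
  moreover have "det (mat 1 + mat (e x) ** Y x) = ?T id x + (\<Sum>p\<in>?P - {id}. ?T p x)" for x
    unfolding det_def by (subst sum.remove[of _ id]) (auto simp: permutes_id finite_permutations)
  moreover have "?T id x = (\<Prod>i\<in>UNIV. 1 + e x * Y x $ i $ i)" for x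
    by (simp add: sign_id mat_nth)
  ultimately show ?thesis
    unfolding trace_def by (auto dest: sum_in_bigo(1) simp: algebra_simps)
qed

section \<open>The matrix of derivatives\<close>

lemma scalar_product_vec_mult: "scalar_product z (A *v w) = scalar_product (z v* A) (w :: complex^'n)"
proof -
  have "scalar_product z (A *v w) = (\<Sum>i\<in>UNIV. \<Sum>j\<in>UNIV. z $ i * A $ i $ j * w $ j)"
    by (simp add: scalar_product_def matrix_vector_mult_def sum_distrib_left mult_ac)
  also have "\<dots> = scalar_product (z v* A) w"
    by (subst sum.swap) (simp add: scalar_product_def vector_matrix_mult_def sum_distrib_left sum_distrib_right mult_ac)
  finally show ?thesis .
qed

lemma scalar_product_add_left: "scalar_product (u + v) w = scalar_product u w + scalar_product v (w :: complex^'n)"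
  and scalar_product_add_right: "scalar_product w (u + v) = scalar_product w u + scalar_product w (v :: complex^'n)"
  by (simp_all add: scalar_product_def algebra_simps sum.distrib)

lemma scalar_product_diff_right: "scalar_product w (u - v) = scalar_product w u - scalar_product w (v :: complex^'n)"
  by (simp add: scalar_product_def algebra_simps sum_subtractf)

lemma scalar_product_axis_left: "scalar_product (axis i 1) w = w $ i"
  and scalar_product_axis_right: "scalar_product w (axis i 1) = (w :: complex^'n) $ i"
  by (simp_all add: scalar_product_def axis_def if_distrib if_distribR cong: if_cong)

lemma matrix_mult_axis: "((A :: complex^'n^'m) *v axis j 1) $ i = A $ i $ j"
  by (simp add: matrix_vector_mult_def axis_def if_distrib if_distribR cong: if_cong)

lemma h_fun_shift_z: "h_fun \<gamma> (z + t *s axis i 1, w) = h_fun \<gamma> (z, w) - t * (\<gamma> *v w) $ i"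
  by (simp add: h_fun_def scalar_product_add_left scalar_product_axis_left)

lemma h_fun_shift_w: "h_fun \<gamma> (z, w + t *s axis j 1) = h_fun \<gamma> (z, w) - t * (z v* \<gamma>) $ j"
  by (simp add: h_fun_def scalar_product_vec_mult scalar_product_add_right scalar_product_axis_right)

lemma has_field_derivative_inverse_power:
  assumes "(h::complex) \<noteq> 0"
  shows "((\<lambda>t. inverse ((h - t * a) ^ n)) has_field_derivative of_nat n * inverse (h ^ (n + 1)) * a) (at 0)"
proof (cases n)
  case (Suc m)
  have lin: "((\<lambda>t. h - t * a) has_field_derivative - a) (at 0)"
    by (auto intro!: derivative_eq_intros)
  have "((\<lambda>t. inverse ((h - t * a) ^ n)) has_field_derivative
      - (inverse ((h - 0 * a) ^ n) * (of_nat n * (- a * (h - 0 * a) ^ (n - Suc 0))) * inverse ((h - 0 * a) ^ n))) (at 0)"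
    using assms by (intro DERIV_inverse' DERIV_power lin) simp
  also have "- (inverse ((h - 0 * a) ^ n) * (of_nat n * (- a * (h - 0 * a) ^ (n - Suc 0))) * inverse ((h - 0 * a) ^ n))
      = of_nat n * inverse (h ^ (n + 1)) * a"
    unfolding Suc using assms by (simp add: field_simps)
  finally show ?thesis .
qed simp

lemma eventually_regular_shift:
  assumes "finite \<Gamma>" "(z, w) \<in> regular_points \<Gamma>"
  shows "eventually (\<lambda>t. (z, w + t *s axis j 1) \<in> regular_points \<Gamma>) (nhds 0)"
proof -
  have "eventually (\<lambda>t. h_fun \<gamma> (z, w) - t * (z v* \<gamma>) $ j \<noteq> 0) (nhds 0)" if "\<gamma> \<in> \<Gamma>" for \<gamma>
  proof -
    have "((\<lambda>t. h_fun \<gamma> (z, w) - t * (z v* \<gamma>) $ j) \<longlongrightarrow> h_fun \<gamma> (z, w) - 0 * (z v* \<gamma>) $ j) (nhds 0)"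
      by (intro tendsto_intros filterlim_ident)
    then show ?thesis
      by (rule tendsto_imp_eventually_ne) (use assms that in \<open>auto simp: regular_points_def\<close>)
  qed
  then show ?thesis
    using assms(1) by (simp add: regular_points_def h_fun_shift_w eventually_ball_finite_distrib)
qed

text \<open>
  The matrix $M(h_\gamma^{-(N+1)})$.
\<close>

definition kernel_block :: "complex^'n^'n \<Rightarrow> (complex^'n) \<times> (complex^'n) \<Rightarrow> complex^('n option)^('n option)"
  where "kernel_block \<gamma> p = (let k = h_fun \<gamma> p; s = of_nat (CARD('n) + 1) in
    bordered (inverse (k ^ (CARD('n) + 1)))
      ((s * inverse (k ^ (CARD('n) + 2))) *s (fst p v* \<gamma>))
      ((s * inverse (k ^ (CARD('n) + 2))) *s (\<gamma> *v snd p))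
      (outer ((s * (s + 1) * inverse (k ^ (CARD('n) + 3))) *s (\<gamma> *v snd p)) (fst p v* \<gamma>)
        + mat (s * inverse (k ^ (CARD('n) + 2))) ** \<gamma>))"

lemma deriv_z_phi:
  fixes \<Gamma> :: "(complex^'n^'n) set"
  assumes "(z, w) \<in> regular_points \<Gamma>"
  shows "deriv_z i (phi \<Gamma>) (z, w) =
    (\<Sum>\<gamma>\<in>\<Gamma>. det \<gamma> * (of_nat (CARD('n) + 1) * inverse (h_fun \<gamma> (z, w) ^ (CARD('n) + 2)) * (\<gamma> *v w) $ i))"
proof -
  have "((\<lambda>t. phi \<Gamma> (z + t *s axis i 1, w)) has_field_derivative
    (\<Sum>\<gamma>\<in>\<Gamma>. det \<gamma> * (of_nat (CARD('n) + 1) * inverse (h_fun \<gamma> (z, w) ^ (CARD('n) + 1 + 1)) * (\<gamma> *v w) $ i))) (at 0)"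
    unfolding phi_def h_fun_shift_z
    by (intro DERIV_sum DERIV_cmult has_field_derivative_inverse_power)
       (use assms in \<open>auto simp: regular_points_def\<close>)
  then show ?thesis by (simp add: deriv_z_def DERIV_imp_deriv)
qed

lemma deriv_w_phi:
  fixes \<Gamma> :: "(complex^'n^'n) set"
  assumes "(z, w) \<in> regular_points \<Gamma>"
  shows "deriv_w j (phi \<Gamma>) (z, w) =
    (\<Sum>\<gamma>\<in>\<Gamma>. det \<gamma> * (of_nat (CARD('n) + 1) * inverse (h_fun \<gamma> (z, w) ^ (CARD('n) + 2)) * (z v* \<gamma>) $ j))"
proof -
  have "((\<lambda>t. phi \<Gamma> (z, w + t *s axis j 1)) has_field_derivative
    (\<Sum>\<gamma>\<in>\<Gamma>. det \<gamma> * (of_nat (CARD('n) + 1) * inverse (h_fun \<gamma> (z, w) ^ (CARD('n) + 1 + 1)) * (z v* \<gamma>) $ j))) (at 0)"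
    unfolding phi_def h_fun_shift_w
    by (intro DERIV_sum DERIV_cmult has_field_derivative_inverse_power)
       (use assms in \<open>auto simp: regular_points_def\<close>)
  then show ?thesis by (simp add: deriv_w_def DERIV_imp_deriv)
qed

lemma deriv_w_deriv_z_phi:
  fixes \<Gamma> :: "(complex^'n^'n) set"
  assumes "finite \<Gamma>" and p: "(z, w) \<in> regular_points \<Gamma>"
  shows "deriv_w j (deriv_z i (phi \<Gamma>)) (z, w) =
    (\<Sum>\<gamma>\<in>\<Gamma>. det \<gamma> * (of_nat (CARD('n) + 1) * of_nat (CARD('n) + 2) * inverse (h_fun \<gamma> (z, w) ^ (CARD('n) + 3))
          * (\<gamma> *v w) $ i * (z v* \<gamma>) $ j
       + of_nat (CARD('n) + 1) * inverse (h_fun \<gamma> (z, w) ^ (CARD('n) + 2)) * \<gamma> $ i $ j))"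
proof -
  have e: "(\<gamma> *v (w + t *s axis j 1)) $ i = (\<gamma> *v w) $ i + t * \<gamma> $ i $ j" for \<gamma> :: "complex^'n^'n" and t
    by (simp add: matrix_vector_right_distrib vector_scalar_commute matrix_mult_axis)
  have "((\<lambda>t. \<Sum>\<gamma>\<in>\<Gamma>. det \<gamma> * (of_nat (CARD('n) + 1) * inverse (h_fun \<gamma> (z, w + t *s axis j 1) ^ (CARD('n) + 2))
      * (\<gamma> *v (w + t *s axis j 1)) $ i)) has_field_derivative
    (\<Sum>\<gamma>\<in>\<Gamma>. det \<gamma> * (of_nat (CARD('n) + 1) * (of_nat (CARD('n) + 2) * inverse (h_fun \<gamma> (z, w) ^ (CARD('n) + 2 + 1)) * (z v* \<gamma>) $ j)
          * ((\<gamma> *v w) $ i + 0 * \<gamma> $ i $ j)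
       + (0 + 1 * \<gamma> $ i $ j) * (of_nat (CARD('n) + 1) * inverse ((h_fun \<gamma> (z, w) - 0 * (z v* \<gamma>) $ j) ^ (CARD('n) + 2)))))) (at 0)"
    unfolding h_fun_shift_w e
    by (intro DERIV_sum DERIV_cmult DERIV_mult has_field_derivative_inverse_power DERIV_add DERIV_const DERIV_cmult_right DERIV_ident)
       (use p in \<open>auto simp: regular_points_def\<close>)
  then have "deriv (\<lambda>t. \<Sum>\<gamma>\<in>\<Gamma>. det \<gamma> * (of_nat (CARD('n) + 1) * inverse (h_fun \<gamma> (z, w + t *s axis j 1) ^ (CARD('n) + 2))
      * (\<gamma> *v (w + t *s axis j 1)) $ i)) 0 =
    (\<Sum>\<gamma>\<in>\<Gamma>. det \<gamma> * (of_nat (CARD('n) + 1) * of_nat (CARD('n) + 2) * inverse (h_fun \<gamma> (z, w) ^ (CARD('n) + 3))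
          * (\<gamma> *v w) $ i * (z v* \<gamma>) $ j
       + of_nat (CARD('n) + 1) * inverse (h_fun \<gamma> (z, w) ^ (CARD('n) + 2)) * \<gamma> $ i $ j))"
    by (subst DERIV_imp_deriv, assumption) (simp add: mult_ac numeral_3_eq_3)
  moreover have "deriv (\<lambda>t. deriv_z i (phi \<Gamma>) (z, w + t *s axis j 1)) 0 =
     deriv (\<lambda>t. \<Sum>\<gamma>\<in>\<Gamma>. det \<gamma> * (of_nat (CARD('n) + 1) * inverse (h_fun \<gamma> (z, w + t *s axis j 1) ^ (CARD('n) + 2))
      * (\<gamma> *v (w + t *s axis j 1)) $ i)) 0"
    by (intro deriv_cong_ev refl eventually_mono[OF eventually_regular_shift[OF assms]] deriv_z_phi)
  ultimately show ?thesis
    unfolding deriv_w_def by simp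
qed

lemma M_matrix_phi:
  fixes \<Gamma> :: "(complex^'n^'n) set"
  assumes "finite \<Gamma>" and p: "(z, w) \<in> regular_points \<Gamma>"
  shows "M_matrix (phi \<Gamma>) (z, w) = (\<Sum>\<gamma>\<in>\<Gamma>. mat (det \<gamma>) ** kernel_block \<gamma> (z, w))"
  by (rule option_matrix_eqI)
     (simp_all add: M_matrix_def kernel_block_def Let_def deriv_w_deriv_z_phi[OF assms]
       deriv_z_phi[OF p] deriv_w_phi[OF p] phi_def outer_def mult_ac add_ac numeral_3_eq_3)

section \<open>An isolated intersection of two polar hypersurfaces\<close>

lemma matrix_mult_add_rdistrib: "(A + B) ** C = A ** C + B ** (C :: complex^'k^'n)"
  by (simp add: vec_eq_iff matrix_matrix_mult_def algebra_simps sum.distrib)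

text \<open>
  By induction, a point that is good for the first functions is joined by a line to a point that is
  good for the next one. Along this line each function is a nonzero polynomial, so only finitely
  many parameters are bad.
\<close>

lemma common_nonzero_point:
  fixes f :: "'i \<Rightarrow> complex^'n \<Rightarrow> complex"
  assumes "finite I" "S \<noteq> {}"
    and line: "\<And>x y e. x \<in> S \<Longrightarrow> y \<in> S \<Longrightarrow> x + e *s (y - x) \<in> S"
    and poly: "\<And>i x y. i \<in> I \<Longrightarrow> \<exists>p. \<forall>e. f i (x + e *s (y - x)) = poly p e"
    and nonzero: "\<And>i. i \<in> I \<Longrightarrow> \<exists>x\<in>S. f i x \<noteq> 0"
  shows "\<exists>x\<in>S. \<forall>i\<in>I. f i x \<noteq> 0"
  using \<open>finite I\<close> poly nonzero
proof (induction I rule: finite_induct)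
  case empty
  then show ?case using \<open>S \<noteq> {}\<close> by auto
next
  case (insert a I)
  then obtain x where x: "x \<in> S" "\<forall>i\<in>I. f i x \<noteq> 0" by (metis insertCI)
  from insert obtain y where y: "y \<in> S" "f a y \<noteq> 0" by blast
  have "\<forall>i\<in>insert a I. \<exists>p. \<forall>e. f i (x + e *s (y - x)) = poly p e" using insert by auto
  then obtain p where p: "\<And>i e. i \<in> insert a I \<Longrightarrow> f i (x + e *s (y - x)) = poly (p i) e"
    by metis
  have "p i \<noteq> 0" if "i \<in> insert a I" for i
    using p[OF that, of 0] p[OF that, of 1] x y that by auto
  then have "finite (\<Union>i\<in>insert a I. {e. poly (p i) e = 0})"
    using insert by (intro finite_UN_I) (auto intro!: poly_roots_finite)
  then obtain e where "e \<notin> (\<Union>i\<in>insert a I. {e. poly (p i) e = 0})"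
    using infinite_UNIV_char_0 ex_new_if_finite by blast
  then show ?case
    using p line[OF \<open>x \<in> S\<close> \<open>y \<in> S\<close>] by (intro bexI[of _ "x + e *s (y - x)"]) auto
qed

lemma nonzero_minor:
  fixes b y :: "complex^'n"
  assumes "y \<noteq> 0" "\<And>c. b \<noteq> c *s y"
  obtains i j where "b $ i * y $ j - b $ j * y $ i \<noteq> 0"
proof (rule ccontr)
  assume *: "\<not> thesis"
  from \<open>y \<noteq> 0\<close> obtain j where j: "y $ j \<noteq> 0" by (auto simp: vec_eq_iff)
  have "b = (b $ j / y $ j) *s y"
    using * that[of _ j] j by (auto simp: vec_eq_iff field_simps)
  with assms(2) show False by blast
qed

lemma matrix_eqI_vec: "(\<And>v. A *v v = B *v v) \<Longrightarrow> A = (B :: complex^'n^'m)"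
  by (simp add: matrix_eq)

text \<open>
  The factors at two basis vectors agree: compare them with the factor at the sum of these
  vectors, whose images under the injective matrix are independent.
\<close>

lemma pointwise_proportional_imp_proportional:
  fixes A B :: "complex^'n^'n"
  assumes inj: "\<And>v. A *v v = 0 \<Longrightarrow> v = 0"
    and dep: "\<And>v. \<exists>c. B *v v = c *s (A *v v)"
  shows "\<exists>c. B = mat c ** A"
proof -
  from dep obtain c where c: "\<And>v. B *v v = c v *s (A *v v)" by metis
  define d where "d i = c (axis i 1)" for i
  have "d i = d j" for i j
  proof (cases "i = j")
    case False
    let ?c = "c (axis i 1 + axis j 1)"
    have "?c *s (A *v axis i 1) + ?c *s (A *v axis j 1) = d i *s (A *v axis i 1) + d j *s (A *v axis j 1)"
      unfolding d_def c[symmetric] using c[of "axis i 1 + axis j 1"]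
      by (simp add: matrix_vector_right_distrib vector_add_ldistrib)
    then have "A *v ((?c - d i) *s axis i 1 + (?c - d j) *s axis j 1) = 0"
      by (simp add: matrix_vector_right_distrib vector_scalar_commute vec_eq_iff algebra_simps)
    then have "(?c - d i) *s axis i 1 + (?c - d j) *s axis j 1 = (0 :: complex^'n)" by (rule inj)
    then have "((?c - d i) *s axis i 1 + (?c - d j) *s axis j 1) $ k = (0 :: complex)" for k
      by simp
    from this[of i] this[of j] False show ?thesis by (simp add: axis_def)
  qed simp
  then obtain e where e: "\<And>i. d i = e" by metis
  have "B $ k $ l = e * A $ k $ l" for k l
    using c[of "axis l 1"] e[of l] unfolding d_def
    by (metis matrix_mult_axis vector_smult_component)
  then have "B = mat e ** A" by (simp add: vec_eq_iff)
  then show ?thesis ..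
qed

text \<open>
  For a single \<open>B\<close> the preceding lemma gives a vector at which some $2\times 2$ minor of the pair
  of images is nonzero. These minors are polynomials, so one vector serves all \<open>B\<close> at once.
\<close>

lemma generic_vector:
  fixes A :: "complex^'n^'n"
  assumes "finite \<B>" and inj: "\<And>v. A *v v = 0 \<Longrightarrow> v = 0"
    and nonprop: "\<And>B c. B \<in> \<B> \<Longrightarrow> B \<noteq> mat c ** A"
  shows "\<exists>w. \<forall>B\<in>\<B>. \<forall>c. B *v w \<noteq> c *s (A *v w)"
proof -
  have "\<exists>i j w. (B *v w) $ i * (A *v w) $ j - (B *v w) $ j * (A *v w) $ i \<noteq> 0" if "B \<in> \<B>" for B
  proof -
    have "\<not> (\<forall>w. \<exists>c. B *v w = c *s (A *v w))"
    proof
      assume "\<forall>w. \<exists>c. B *v w = c *s (A *v w)"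
      then have "\<exists>c. B = mat c ** A"
        using pointwise_proportional_imp_proportional[OF inj] by blast
      with nonprop[OF that] show False by blast
    qed
    then obtain w where w: "\<And>c. B *v w \<noteq> c *s (A *v w)" by blast
    then have "w \<noteq> 0" by (metis matrix_vector_mult_0_right vector_smult_lzero)
    then have "A *v w \<noteq> 0" using inj by blast
    with w show ?thesis by (metis nonzero_minor)
  qed
  then obtain i j where ij:
    "\<And>B. B \<in> \<B> \<Longrightarrow> \<exists>w. (B *v w) $ i B * (A *v w) $ j B - (B *v w) $ j B * (A *v w) $ i B \<noteq> 0"
    by metis
  have "\<exists>w\<in>UNIV. \<forall>B\<in>\<B>. (B *v w) $ i B * (A *v w) $ j B - (B *v w) $ j B * (A *v w) $ i B \<noteq> 0"
  proof (rule common_nonzero_point)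
    fix B x y
    have lin: "(C *v (x + e *s (y - x))) $ l = poly [:(C *v x) $ l, (C *v y) $ l - (C *v x) $ l:] e"
      for C :: "complex^'n^'n" and l e
      by (simp add: matrix_vector_right_distrib matrix_vector_mult_diff_distrib vector_scalar_commute right_diff_distrib)
    show "\<exists>p. \<forall>e. (B *v (x + e *s (y - x))) $ i B * (A *v (x + e *s (y - x))) $ j B
        - (B *v (x + e *s (y - x))) $ j B * (A *v (x + e *s (y - x))) $ i B = poly p e"
      unfolding lin poly_mult[symmetric] poly_diff[symmetric] by blast
  qed (use assms ij in auto)
  then obtain w where w: "\<And>B. B \<in> \<B> \<Longrightarrow> (B *v w) $ i B * (A *v w) $ j B - (B *v w) $ j B * (A *v w) $ i B \<noteq> 0"
    by auto
  have "B *v w \<noteq> c *s (A *v w)" if "B \<in> \<B>" for B c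
    using w[OF that] by auto
  then show ?thesis by blast
qed

lemma generic_covector:
  fixes y :: "complex^'n"
  assumes "finite V" "y \<noteq> 0" and nonprop: "\<And>b c. b \<in> V \<Longrightarrow> b \<noteq> c *s y"
  shows "\<exists>z. scalar_product z y = 0 \<and> (\<forall>b\<in>V. scalar_product z b \<noteq> 0)"
proof -
  have "\<exists>z\<in>{z. scalar_product z y = 0}. \<forall>b\<in>V. scalar_product z b \<noteq> 0"
  proof (rule common_nonzero_point)
    have "scalar_product 0 y = 0" by (simp add: scalar_product_def)
    then show "{z. scalar_product z y = 0} \<noteq> {}" by blast
  next
    fix b assume "b \<in> V"
    then obtain i j where ij: "b $ i * y $ j - b $ j * y $ i \<noteq> 0"
      using nonzero_minor[OF \<open>y \<noteq> 0\<close>] nonprop by metis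
    define z where "z = y $ j *s axis i 1 + (- y $ i) *s axis j (1 :: complex)"
    have z: "scalar_product z v = y $ j * v $ i - y $ i * v $ j" for v
      unfolding z_def scalar_product_add_left scalar_product_scale scalar_product_axis_left by simp
    show "\<exists>z\<in>{z. scalar_product z y = 0}. scalar_product z b \<noteq> 0"
      using ij by (intro bexI[of _ z]) (auto simp: z mult.commute)
  next
    fix b x x' :: "complex^'n"
    have "scalar_product (x + e *s (x' - x)) b =
        poly [:scalar_product x b, scalar_product x' b - scalar_product x b:] e" for e
      by (simp add: scalar_product_def sum.distrib sum_subtractf sum_distrib_left algebra_simps)
    then show "\<exists>p. \<forall>e. scalar_product (x + e *s (x' - x)) b = poly p e" by blast
  next
    show "x + e *s (x' - x) \<in> {z. scalar_product z y = 0}"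
      if "x \<in> {z. scalar_product z y = 0}" "x' \<in> {z. scalar_product z y = 0}" for x x' e
    proof -
      have "scalar_product (x + e *s (x' - x)) y =
        scalar_product x y + e * (scalar_product x' y - scalar_product x y)"
        by (simp add: scalar_product_def sum.distrib sum_subtractf sum_distrib_left algebra_simps)
      with that show ?thesis by simp
    qed
  qed (use assms in auto)
  then show ?thesis by auto
qed

text \<open>
  Seen through eigenvalues, $1 + c(\lambda - 1)$ would have to lie on the unit circle for every
  eigenvalue $\lambda$ of \<open>\<gamma>\<close>; for $c \neq 1$ two distinct circles meet in at most two points,
  one of which is the excluded value 1, so there is only one eigenvalue. The proof is algebraic: with $\eta = \gamma - 1$,
  unitarity reads $\eta + \eta^* + \eta^*\eta = 0$. The corresponding equation for $c\eta$ makes $\eta^*$ a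
  multiple of $\eta$, whence $\eta^2$ is a multiple of $\eta$, and $\eta$ can be cancelled.
\<close>

lemma unitary_collinear_with_identity:
  fixes \<gamma> \<delta> :: "complex^'n^'n"
  assumes \<gamma>: "unitary_matrix \<gamma>" and \<delta>: "unitary_matrix \<delta>"
    and inj: "\<And>v. (\<gamma> - mat 1) *v v = 0 \<Longrightarrow> v = 0"
    and ne: "\<delta> \<noteq> mat 1" "\<delta> \<noteq> \<gamma>" and eq: "\<delta> - mat 1 = mat c ** (\<gamma> - mat 1)"
  shows "\<exists>a. \<gamma> = mat a"
proof -
  define \<eta> where "\<eta> = \<gamma> - mat 1"
  define H where "H = conj_transpose \<eta>"
  have ct: "conj_transpose (A + B) = conj_transpose A + conj_transpose B"
    "conj_transpose (mat c ** A) = mat (cnj c) ** conj_transpose A" for A B :: "complex^'n^'n" and c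
    by (simp_all add: vec_eq_iff conj_transpose_def)
  have *: "cnj e * H $ i $ j + e * \<eta> $ i $ j + e * cnj e * (H ** \<eta>) $ i $ j = 0"
    if "unitary_matrix (mat 1 + mat e ** \<eta>)" for e i j
  proof -
    have "mat 1 = (mat 1 + mat (cnj e) ** H) ** (mat 1 + mat e ** \<eta>)"
      using that by (simp add: unitary_matrix_def ct conj_transpose_mat1 H_def)
    also have "\<dots> = mat 1 + (mat (cnj e) ** H + mat e ** \<eta> + mat (cnj e) ** (H ** (mat e ** \<eta>)))"
      by (simp add: matrix_add_ldistrib matrix_mult_add_rdistrib matrix_mul_assoc)
    also have "H ** (mat e ** \<eta>) = mat e ** (H ** \<eta>)"
      by (simp add: vec_eq_iff) (simp add: matrix_matrix_mult_def mat_nth sum_distrib_left mult_ac if_distrib if_distribR cong: if_cong)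
    finally have "mat (cnj e) ** H + mat e ** \<eta> + mat (cnj e) ** (mat e ** (H ** \<eta>)) = 0"
      by simp
    then have "(mat (cnj e) ** H + mat e ** \<eta> + mat (cnj e) ** (mat e ** (H ** \<eta>))) $ i $ j = 0"
      by simp
    then show ?thesis by (simp add: mult_ac)
  qed
  have "\<gamma> = mat 1 + mat 1 ** \<eta>" "\<delta> = mat 1 + mat c ** \<eta>"
    using eq by (simp_all add: \<eta>_def algebra_simps)
  then have e1: "H $ i $ j + \<eta> $ i $ j + (H ** \<eta>) $ i $ j = 0"
    and ec: "cnj c * H $ i $ j + c * \<eta> $ i $ j + c * cnj c * (H ** \<eta>) $ i $ j = 0" for i j
    using *[of 1 i j] *[of c i j] \<gamma> \<delta> by simp_all
  have c: "c \<noteq> 0" "c \<noteq> 1"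
    using ne eq by (auto simp: vec_eq_iff mat_nth)
  define k where "k = - (c * (1 - cnj c)) / (cnj c * (1 - c))"
  have "k \<noteq> 0" using c by (auto simp: k_def)
  have H: "H $ i $ j = k * \<eta> $ i $ j" for i j
  proof -
    have X: "(H ** \<eta>) $ i $ j = - H $ i $ j - \<eta> $ i $ j"
      using e1[of i j] by (simp add: algebra_simps add_eq_0_iff)
    then have "cnj c * (1 - c) * H $ i $ j = - (c * (1 - cnj c)) * \<eta> $ i $ j"
      using ec[of i j] unfolding X by (simp add: algebra_simps)
    then show ?thesis using c by (simp add: k_def field_simps)
  qed
  then have H': "H = mat k ** \<eta>" by (simp add: vec_eq_iff)
  have "\<eta> *v v = (- (1 + k) / k) *s v" for v
  proof -
    have "H + \<eta> + H ** \<eta> = 0" using e1 by (simp add: vec_eq_iff)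
    then have "(H + \<eta> + H ** \<eta>) *v v = 0" by simp
    then have "k *s (\<eta> *v v) + \<eta> *v v + k *s (\<eta> *v (\<eta> *v v)) = 0"
      by (simp add: H' matrix_vector_mult_add_rdistrib matrix_vector_mul_assoc[symmetric])
    then have "\<eta> *v ((1 + k) *s v + k *s (\<eta> *v v)) = 0"
      by (simp add: matrix_vector_right_distrib vector_scalar_commute vec_eq_iff algebra_simps)
    then have "(1 + k) *s v + k *s (\<eta> *v v) = 0"
      using inj by (simp add: \<eta>_def)
    then have "k * (\<eta> *v v) $ i = - (1 + k) * v $ i" for i
      by (auto simp: vec_eq_iff algebra_simps add_eq_0_iff)
    then show ?thesis using \<open>k \<noteq> 0\<close> by (simp add: vec_eq_iff field_simps)
  qed
  then have "\<eta> = mat (- (1 + k) / k)" by (intro matrix_eqI_vec) simp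
  then have "\<gamma> = mat (- (1 + k) / k + 1)"
    unfolding \<eta>_def by (auto simp: vec_eq_iff mat_nth algebra_simps split: if_splits)
  then show ?thesis ..
qed

text \<open>
  A point on $h_1 = h_\gamma = 0$ at which no other pole of $\phi_\Gamma$ lies, together with a direction $d$
  for $z$ that stays in $h_1 = 0$ and leaves $h_\gamma = 0$. With $\eta = \gamma - 1$ the conditions
  $h_1 = h_\gamma = 0$ read $z^T w = 1$, $z^T \eta w = 0$, and those to be avoided have the form
  $z^T B w = 0$ with $B$ among $1$, $\gamma^2 - 1$ and $\delta - 1$. None of these $B$ is a multiple of $\eta$, so a
  generic $w$ has $Bw$ independent of $\eta w$, and then a generic $z$ orthogonal to $\eta w$ works.
\<close>

lemma isolated_double_zero:
  fixes \<Gamma> :: "(complex^'n^'n) set"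
  assumes "finite \<Gamma>" and unitary: "\<And>\<delta>. \<delta> \<in> \<Gamma> \<Longrightarrow> unitary_matrix \<delta>" and "fixed_point_free \<Gamma>"
    and \<gamma>: "\<gamma> \<in> \<Gamma>" and nonscalar: "\<And>a. \<gamma> \<noteq> mat a"
  obtains z w d where "h_fun (mat 1) (z, w) = 0" "h_fun \<gamma> (z, w) = 0"
    "scalar_product z (\<gamma> *v (\<gamma> *v w)) \<noteq> 1"
    "\<And>\<delta>. \<delta> \<in> \<Gamma> - {mat 1, \<gamma>} \<Longrightarrow> h_fun \<delta> (z, w) \<noteq> 0"
    "scalar_product d w = 0" "scalar_product d (\<gamma> *v w) \<noteq> 0"
proof -
  define \<eta> where "\<eta> = \<gamma> - mat 1"
  have inj: "v = 0" if "\<eta> *v v = 0" for v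
    using that assms(3) \<gamma> nonscalar[of 1]
    by (auto simp: fixed_point_free_def matrix_eigenvalue_def \<eta>_def matrix_vector_mult_diff_rdistrib)
  let ?\<B> = "insert (mat 1) (insert (\<gamma> ** \<gamma> - mat 1) ((\<lambda>\<delta>. \<delta> - mat 1) ` (\<Gamma> - {mat 1, \<gamma>})))"
  have not_scalar: "\<exists>v. \<eta> *v v \<noteq> c *s v" for c
  proof (rule ccontr)
    assume "\<nexists>v. \<eta> *v v \<noteq> c *s v"
    then have "\<gamma> *v v = (c + 1) *s v" for v
      by (simp add: \<eta>_def matrix_vector_mult_diff_rdistrib vec_eq_iff algebra_simps)
    then have "\<gamma> = mat (c + 1)" by (intro matrix_eqI_vec) simp
    with nonscalar show False by blast
  qed
  have nonprop: "B \<noteq> mat c ** \<eta>" if "B \<in> ?\<B>" for B c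
  proof
    assume eq: "B = mat c ** \<eta>"
    have eqv: "B *v v = c *s (\<eta> *v v)" for v
      unfolding eq by (simp add: matrix_vector_mul_assoc[symmetric])
    from that consider "B = mat 1" | "B = \<gamma> ** \<gamma> - mat 1" | \<delta> where "\<delta> \<in> \<Gamma> - {mat 1, \<gamma>}" "B = \<delta> - mat 1"
      by auto
    then show False
    proof cases
      case 1
      then have *: "v = c *s (\<eta> *v v)" for v using eqv[of v] by simp
      have "c \<noteq> 0"
        using *[of "axis undefined 1"] by (metis axis_eq_0_iff one_neq_zero vector_smult_lzero)
      then have "\<eta> *v v = (1 / c) *s v" for v
        using *[of v] by (metis vector_smult_assoc nonzero_divide_eq_eq mult.commute vector_smult_lid)
      with not_scalar show False by blast
    next
      case 2
      \<comment> \<open>Since $\gamma^2 - 1 = \eta(\eta + 2)$, the injective $\eta$ cancels.\<close>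
      have "\<eta> *v v = (c - 2) *s v" for v
      proof -
        have "B *v v = \<eta> *v (\<eta> *v v + 2 *s v)"
          unfolding 2 \<eta>_def by (simp add: matrix_vector_mult_diff_rdistrib matrix_vector_right_distrib
             matrix_vector_mult_diff_distrib matrix_vector_mul_assoc[symmetric] vector_scalar_commute vec_eq_iff)
        then have "\<eta> *v (\<eta> *v v + 2 *s v - c *s v) = 0"
          using eqv[of v] by (simp add: matrix_vector_mult_diff_distrib vector_scalar_commute)
        then have "\<eta> *v v + 2 *s v - c *s v = 0" by (rule inj)
        then show ?thesis by (simp add: vec_eq_iff algebra_simps)
      qed
      with not_scalar show False by blast
    next
      case 3
      then have "\<exists>a. \<gamma> = mat a"
        using unitary_collinear_with_identity[of \<gamma> \<delta> c] unitary \<gamma> eq inj by (auto simp: \<eta>_def)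
      with nonscalar show False by blast
    qed
  qed
  obtain w where w: "\<And>B c. B \<in> ?\<B> \<Longrightarrow> B *v w \<noteq> c *s (\<eta> *v w)"
    using generic_vector[of ?\<B> \<eta>] \<open>finite \<Gamma>\<close> inj nonprop by (metis (no_types, lifting) finite.insertI finite_Diff finite_imageI)
  have w1: "w \<noteq> c *s (\<eta> *v w)" for c
    using w[of "mat 1" c] by simp
  have "w \<noteq> 0" using w1[of 0] by auto
  then have nz: "\<eta> *v w \<noteq> 0" using inj by blast
  have "\<exists>z. scalar_product z (\<eta> *v w) = 0 \<and> (\<forall>b\<in>(\<lambda>B. B *v w) ` ?\<B>. scalar_product z b \<noteq> 0)"
  proof (rule generic_covector)
    show "finite ((\<lambda>B. B *v w) ` ?\<B>)" using \<open>finite \<Gamma>\<close> by simp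
    show "b \<noteq> c *s (\<eta> *v w)" if "b \<in> (\<lambda>B. B *v w) ` ?\<B>" for b c
    proof -
      from that obtain B where "b = B *v w" "B \<in> ?\<B>" by (rule imageE)
      then show ?thesis using w[of B c] by simp
    qed
  qed (rule nz)
  then obtain z0 where z0: "scalar_product z0 (\<eta> *v w) = 0" "\<forall>b\<in>(\<lambda>B. B *v w) ` ?\<B>. scalar_product z0 b \<noteq> 0"
    by (elim exE conjE)
  have z0': "scalar_product z0 (B *v w) \<noteq> 0" if "B \<in> ?\<B>" for B
    using bspec[OF z0(2) imageI[OF that]] .
  define z where "z = (1 / scalar_product z0 w) *s z0"
  have "scalar_product z0 w \<noteq> 0" using z0'[of "mat 1"] by simp
  then have z: "scalar_product z w = 1" "scalar_product z (\<eta> *v w) = 0"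
      "\<And>B. B \<in> ?\<B> \<Longrightarrow> scalar_product z (B *v w) \<noteq> 0"
    using z0(1) z0' by (simp_all add: z_def)
  have minus1: "scalar_product z ((A - mat 1) *v w) = scalar_product z (A *v w) - 1" for A
    using z(1) by (simp add: matrix_vector_mult_diff_rdistrib scalar_product_diff_right)
  have "\<eta> *v w \<noteq> c *s w" for c
  proof
    assume eq: "\<eta> *v w = c *s w"
    with nz have "c \<noteq> 0" by auto
    then have "w = (1 / c) *s (\<eta> *v w)" unfolding eq by (simp add: vector_smult_assoc)
    with w1 show False by blast
  qed
  then obtain d where d: "scalar_product d w = 0" "scalar_product d (\<eta> *v w) \<noteq> 0"
    using generic_covector[of "{\<eta> *v w}" w] \<open>w \<noteq> 0\<close> by auto
  have "scalar_product d (\<gamma> *v w) \<noteq> 0"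
    using d by (simp add: \<eta>_def matrix_vector_mult_diff_rdistrib scalar_product_diff_right)
  moreover have "scalar_product z (\<gamma> *v (\<gamma> *v w)) \<noteq> 1"
    using z(3)[of "\<gamma> ** \<gamma> - mat 1"] by (simp add: minus1 matrix_vector_mul_assoc)
  moreover have "h_fun \<delta> (z, w) \<noteq> 0" if "\<delta> \<in> \<Gamma> - {mat 1, \<gamma>}" for \<delta>
    using z(3)[of "\<delta> - mat 1"] that by (auto simp: minus1 h_fun_def)
  moreover have "h_fun (mat 1) (z, w) = 0" "h_fun \<gamma> (z, w) = 0"
    using z minus1[of \<gamma>] by (simp_all add: h_fun_def \<eta>_def)
  ultimately show ?thesis using d(1) that by blast
qed

section \<open>The linearization along the hypersurface of the identity\<close>

text \<open>
  Let $D = \mathrm{tr}\,\partial_z\partial_w - (R + N + 1)(\bar R + N + 1)$ with the Euler fields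
  $R = \sum z_i \partial_{z_i}$ and $\bar R = \sum w_j \partial_{w_j}$. This is $D(h_\gamma^{-(N+1)})/(N+1)$; the operator
  $D$ is what remains, on $h_1 = 0$, of the linearization of $F$ at $h_1^{-(N+1)}$.
\<close>

definition obstruction :: "complex^'n^'n \<Rightarrow> (complex^'n) \<times> (complex^'n) \<Rightarrow> complex"
  where "obstruction \<gamma> p = (let k = h_fun \<gamma> p in
    of_nat (CARD('n) + 2) * (scalar_product (fst p) (\<gamma> *v (\<gamma> *v snd p)) - 1) * inverse (k ^ (CARD('n) + 3))
    + (trace \<gamma> + 1) * inverse (k ^ (CARD('n) + 2)))"

text \<open>
  Multiplied by $h_1^{N+1}$, this is the inverse of $M(h_1^{-(N+1)})$. It has no pole along $h_1 = 0$,
  which makes $h_1^{N+1}$ a genuine small parameter there.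
\<close>

definition kernel_inverse :: "(complex^'n) \<times> (complex^'n) \<Rightarrow> complex^('n option)^('n option)"
  where "kernel_inverse p = (let h = h_fun (mat 1) p; s = of_nat (CARD('n) + 1) in
    bordered (1 + s - s * h) (- h *s fst p) (- h *s snd p) (mat (h / s) ** (mat 1 - outer (snd p) (fst p))))"

lemma trace_bordered: "trace (bordered a r c B) = a + trace B"
  by (simp add: trace_def sum_option)

lemma trace_mat_mult: "trace (mat c ** A) = c * trace (A :: complex^'n^'n)"
  by (simp add: trace_def sum_distrib_left)

lemma trace_outer: "trace (outer c r) = scalar_product r c"
  by (simp add: trace_def outer_def scalar_product_def mult.commute)

lemma trace_outer_mult: "trace (outer c r ** B) = scalar_product r (B *v c)"
  by (simp add: scalar_product_vec_mult)
     (simp add: trace_def outer_def matrix_matrix_mult_def scalar_product_def vector_matrix_mult_def sum_distrib_left sum_distrib_right mult_ac)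

lemma outer_mult: "outer c r ** B = outer c (r v* B)"
  by (simp add: vec_eq_iff outer_def matrix_matrix_mult_def vector_matrix_mult_def sum_distrib_left mult_ac)

lemma vec_mult_outer: "v v* outer c r = scalar_product v c *s r"
  by (simp add: outer_def vec_eq_iff vector_matrix_mult_def scalar_product_def sum_distrib_left sum_distrib_right mult_ac)

lemma vec_matrix_simps:
  "(c *s v) v* (A :: complex^'n^'m) = c *s (v v* A)"
  "(A :: complex^'n^'m) *v (c *s x) = c *s (A *v x)"
  "v v* (A - B) = v v* A - v v* (B :: complex^'n^'m)"
  "v v* (A + B) = v v* A + v v* (B :: complex^'n^'m)"
  "v v* (mat c ** (A :: complex^'n^'m)) = c *s (v v* A)"
  by (simp_all add: vec_eq_iff vector_matrix_mult_def matrix_vector_mult_def algebra_simps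
     sum_distrib_left sum_distrib_right sum.distrib sum_subtractf)

lemma matrix_mult_diff_rdistrib: "(A - B) ** C = A ** C - B ** (C :: complex^'k^'n)"
  by (simp add: vec_eq_iff matrix_matrix_mult_def algebra_simps sum_subtractf)

lemma matrix_mat_commute: "A ** (mat c ** B) = mat c ** (A ** (B :: complex^'k^'n))"
  by (simp add: vec_eq_iff) (simp add: matrix_matrix_mult_def mat_nth sum_distrib_left mult_ac if_distrib if_distribR cong: if_cong)

lemma inverse_power_Suc:
  assumes "(k :: complex) \<noteq> 0"
  shows "inverse (k ^ (n + 2)) = inverse (k ^ (n + 1)) / k" "inverse (k ^ (n + 3)) = inverse (k ^ (n + 1)) / k ^ 2"
  using assms by (simp_all add: divide_inverse numeral_3_eq_3 power2_eq_square mult_ac)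

lemma kernel_block_mult_inverse:
  fixes z w :: "complex^'n"
  assumes "h_fun (mat 1) (z, w) \<noteq> 0"
  shows "kernel_block (mat 1) (z, w) ** (mat (h_fun (mat 1) (z, w) ^ (CARD('n) + 1)) ** kernel_inverse (z, w)) = mat 1"
proof -
  define h where "h = h_fun (mat 1) (z, w)"
  define s :: complex where "s = of_nat (CARD('n) + 1)"
  have "s \<noteq> 0" unfolding s_def of_nat_eq_0_iff by simp
  have "h \<noteq> 0" using assms by (simp add: h_def)
  have zw: "scalar_product z w = 1 - h" by (simp add: h_def h_fun_def)
  define e where "e = inverse (h ^ (CARD('n) + 1))"
  define H where "H = h ^ (CARD('n) + 1)"
  have "H \<noteq> 0" using \<open>h \<noteq> 0\<close> by (simp add: H_def)
  have e: "e = 1 / H" by (simp add: e_def H_def divide_inverse)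
  have K: "mat H ** kernel_inverse (z, w) = bordered (H * (1 + s - s * h)) ((- H * h) *s z) ((- H * h) *s w)
      (mat (H * h / s) ** (mat 1 - outer w z))"
    unfolding kernel_inverse_def Let_def h_def[symmetric] s_def[symmetric] fst_conv snd_conv
    by (rule option_matrix_eqI) simp_all
  have B: "kernel_block (mat 1) (z, w) = bordered (1 / H) ((s / (H * h)) *s z) ((s / (H * h)) *s w)
      (outer ((s * (s + 1) / (H * h ^ 2)) *s w) z + mat (s / (H * h)))"
    unfolding kernel_block_def Let_def h_def[symmetric] s_def[symmetric] fst_conv snd_conv
      inverse_power_Suc[OF \<open>h \<noteq> 0\<close>] e_def[symmetric] unfolding e
      by simp
  show ?thesis
    unfolding h_def[symmetric] H_def[symmetric] K B bordered_mult
  proof (rule option_matrix_eqI, goal_cases)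
    case 1
    show ?case using \<open>H \<noteq> 0\<close> \<open>h \<noteq> 0\<close> \<open>s \<noteq> 0\<close>
      by (simp add: zw mat_nth; simp add: field_simps)
  next
    case (2 l)
    show ?case using \<open>H \<noteq> 0\<close> \<open>h \<noteq> 0\<close> \<open>s \<noteq> 0\<close>
      by (simp add: vec_matrix_simps vec_mult_outer zw mat_nth; simp add: field_simps)
  next
    case (3 k)
    show ?case using \<open>H \<noteq> 0\<close> \<open>h \<noteq> 0\<close> \<open>s \<noteq> 0\<close>
      by (simp add: vec_matrix_simps outer_mult_vec matrix_vector_mult_add_rdistrib zw mat_nth; simp add: field_simps power2_eq_square)
  next
    case (4 k l)
    have *: "((outer c z + mat d) ** (mat x ** (mat 1 - outer w z))) $ k $ l =
        x * (c $ k * z $ l * h + d * (mat 1 $ k $ l - w $ k * z $ l))" for c d x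
      unfolding matrix_mat_commute matrix_mult_add_rdistrib outer_mult
      by (simp add: vec_matrix_simps vec_mult_outer zw) (simp add: outer_def algebra_simps)
    show ?case using \<open>H \<noteq> 0\<close> \<open>h \<noteq> 0\<close> \<open>s \<noteq> 0\<close>
      by (simp add: *; simp add: outer_def mat_nth field_simps power2_eq_square)
  qed
qed

lemma det_kernel_block_one:
  fixes z w :: "complex^'n"
  assumes "h_fun (mat 1) (z, w) \<noteq> 0"
  shows "det (kernel_block (mat 1) (z, w)) =
    of_nat ((CARD('n) + 1) ^ CARD('n)) * inverse (h_fun (mat 1) (z, w) ^ ((CARD('n) + 1) * (CARD('n) + 2)))"
proof -
  define h where "h = h_fun (mat 1) (z, w)"
  define s :: complex where "s = of_nat (CARD('n) + 1)"
  have s: "s \<noteq> 0" unfolding s_def of_nat_eq_0_iff by simp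
  have h: "h \<noteq> 0" using assms by (simp add: h_def)
  have zw: "scalar_product z w = 1 - h" by (simp add: h_def h_fun_def)
  define e where "e = inverse (h ^ (CARD('n) + 1))"
  have e: "e \<noteq> 0" using h by (simp add: e_def)
  define N where "N = CARD('n) - 1"
  have N: "CARD('n) = Suc N" by (simp add: N_def)
  have "det (kernel_block (mat 1) (z, w)) =
      det (bordered e ((s * e / h) *s z) ((s * e / h) *s w) (outer ((s * (s + 1) * e / h ^ 2) *s w) z + mat (s * e / h)))"
    unfolding kernel_block_def Let_def h_def[symmetric] s_def[symmetric] fst_conv snd_conv
      inverse_power_Suc[OF h] e_def[symmetric] by simp
  also have "\<dots> = (s * e / h) ^ N * (e * (s * e / h) - (1 - h) * ((s * e / h)\<^sup>2 - s * (s + 1) * e / h ^ 2 * e))"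
    using s h e by (subst det_bordered_rank_one) (simp_all add: zw N)
  also have "e * (s * e / h) - (1 - h) * ((s * e / h)\<^sup>2 - s * (s + 1) * e / h ^ 2 * e) = s * e / h * (e / h)"
    using h by (simp add: field_simps power2_eq_square)
  also have "(s * e / h) ^ N * (s * e / h * (e / h)) = s ^ Suc N * (e / h) ^ (N + 2)"
    by (simp add: power_mult_distrib power_divide field_simps)
  also have "e / h = inverse (h ^ (N + 3))"
    by (simp add: e_def N divide_inverse numeral_3_eq_3 mult_ac)
  also have "inverse (h ^ (N + 3)) ^ (N + 2) = inverse (h ^ ((N + 3) * (N + 2)))"
    by (simp only: power_inverse power_mult)
  also have "(N + 3) * (N + 2) = (CARD('n) + 1) * (CARD('n) + 2)"
    by (simp add: N algebra_simps)
  also have "s ^ Suc N = of_nat ((CARD('n) + 1) ^ CARD('n))"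
    by (simp only: s_def N of_nat_power)
  finally show ?thesis by (simp only: h_def)
qed

text \<open>
  The first-order term of $\det M$ under the perturbation of $h_1^{-(N+1)}$ by $h_\gamma^{-(N+1)}$. The
  first summand also arises from the term $(N+1)^N u^{N+2}$ of $F$, so that only the summand with the
  factor $h_1$ survives in $F$.
\<close>

lemma trace_kernel_inverse_mult:
  fixes z w :: "complex^'n"
  assumes k: "h_fun \<gamma> (z, w) \<noteq> 0"
  shows "trace (kernel_inverse (z, w) ** kernel_block \<gamma> (z, w)) =
    of_nat (CARD('n) + 2) * inverse (h_fun \<gamma> (z, w) ^ (CARD('n) + 1)) + h_fun (mat 1) (z, w) * obstruction \<gamma> (z, w)"
proof -
  define h where "h = h_fun (mat 1) (z, w)"
  define k where "k = h_fun \<gamma> (z, w)"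
  define s :: complex where "s = of_nat (CARD('n) + 1)"
  have s: "s \<noteq> 0" unfolding s_def of_nat_eq_0_iff by simp
  have s2: "of_nat (CARD('n) + 2) = s + 1" by (simp add: s_def)
  have k0: "k \<noteq> 0" using k by (simp add: k_def)
  have zw: "scalar_product z w = 1 - h" by (simp add: h_def h_fun_def)
  have zkw: "scalar_product z (\<gamma> *v w) = 1 - k" "scalar_product (z v* \<gamma>) w = 1 - k"
    by (simp_all add: k_def h_fun_def scalar_product_vec_mult)
  define e where "e = inverse (k ^ (CARD('n) + 1))"
  define q where "q = scalar_product z (\<gamma> *v (\<gamma> *v w))"
  have q: "scalar_product (z v* \<gamma>) (\<gamma> *v w) = q" by (simp add: q_def scalar_product_vec_mult)
  define a where "a = (s * (s + 1) * e / k ^ 2)"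
  define b where "b = s * e / k"
  have K: "kernel_block \<gamma> (z, w) = bordered e (b *s (z v* \<gamma>)) (b *s (\<gamma> *v w)) (outer (a *s (\<gamma> *v w)) (z v* \<gamma>) + mat b ** \<gamma>)"
    unfolding kernel_block_def Let_def k_def[symmetric] s_def[symmetric] fst_conv snd_conv
      inverse_power_Suc[OF k0] e_def[symmetric] by (simp add: a_def b_def)
  have "trace ((mat 1 - outer w z) ** (outer (a *s (\<gamma> *v w)) (z v* \<gamma>) + mat b ** \<gamma>))
      = a * q + b * trace \<gamma> - (a * (1 - k)\<^sup>2 + b * (1 - k))"
    by (simp add: matrix_mult_diff_rdistrib trace_sub trace_add trace_outer trace_outer_mult trace_mat_mult q zkw
       matrix_vector_mult_add_rdistrib outer_mult_vec matrix_vector_mul_assoc[symmetric] scalar_product_add_right power2_eq_square)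
  then have "trace (kernel_inverse (z, w) ** kernel_block \<gamma> (z, w)) =
      (1 + s - s * h) * e - 2 * h * b * (1 - k) + h / s * (a * q + b * trace \<gamma> - (a * (1 - k)\<^sup>2 + b * (1 - k)))"
    unfolding kernel_inverse_def K Let_def h_def[symmetric] s_def[symmetric] fst_conv snd_conv
      bordered_mult trace_bordered
    by (simp add: trace_add trace_outer zkw trace_mat_mult matrix_mul_assoc[symmetric])
  also have "\<dots> = (s + 1) * e + h * ((s + 1) * (q - 1) * (e / k ^ 2) + (trace \<gamma> + 1) * (e / k))"
    unfolding a_def b_def using s k0 by (simp add: field_simps power2_eq_square)
  finally show ?thesis
    unfolding obstruction_def Let_def h_def[symmetric] k_def[symmetric] fst_conv snd_conv s2
      inverse_power_Suc[OF k0] e_def[symmetric] q_def[symmetric] .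
qed

lemma matrix_mult_sum_right: "A ** (\<Sum>x\<in>S. f x) = (\<Sum>x\<in>S. A ** (f x :: complex^'k^'n))"
proof (induction S rule: infinite_finite_induct)
  case (insert x F)
  then show ?case by (simp add: matrix_add_ldistrib)
qed simp_all

lemma trace_sum: "trace (\<Sum>x\<in>S. f x) = (\<Sum>x\<in>S. trace (f x :: complex^'n^'n))"
  by (simp add: trace_def) (rule sum.swap)

lemma isCont_imp_bigo_1: "isCont f a \<Longrightarrow> f \<in> O[at a](\<lambda>_. 1 :: complex)" for f :: "complex \<Rightarrow> complex"
  by (rule bigoI_tendsto[of _ _ "f a"]) (simp_all add: isCont_def)

context
  fixes z w :: "complex^'n"
begin

definition ray :: "complex \<Rightarrow> (complex^'n) \<times> (complex^'n)"
  where "ray t = ((1 - t) *s z, w)"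

lemma h_fun_ray: "h_fun \<gamma> (ray t) = 1 - (1 - t) * scalar_product z (\<gamma> *v w)"
  by (simp only: h_fun_def ray_def scalar_product_scale prod.case)

lemma ray_component:
  "scalar_product (fst (ray t)) x = (1 - t) * scalar_product z x"
  "(fst (ray t) v* A) $ j = (1 - t) * (z v* A) $ j"
  "fst (ray t) $ i = (1 - t) * z $ i"
  "snd (ray t) = w"
  by (simp_all only: ray_def fst_conv snd_conv scalar_product_scale vec_matrix_simps vector_smult_component)

lemma isCont_h_fun_ray: "isCont (\<lambda>t. h_fun \<gamma> (ray t)) 0"
  unfolding h_fun_ray by (intro continuous_intros)

lemma ray_0: "ray 0 = (z, w)"
  by (simp add: ray_def)

lemma isCont_kernel_block_ray:
  assumes "h_fun \<gamma> (z, w) \<noteq> 0"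
  shows "isCont (\<lambda>t. kernel_block \<gamma> (ray t) $ i $ j) 0"
proof -
  have [simp]: "h_fun \<gamma> (ray 0) \<noteq> 0" using assms by (simp add: ray_0)
  show ?thesis
    unfolding kernel_block_def Let_def
    by (cases i; cases j)
       (auto simp: outer_def ray_component intro!: continuous_intros isCont_h_fun_ray)
qed

lemma isCont_kernel_inverse_ray: "isCont (\<lambda>t. kernel_inverse (ray t) $ i $ j) 0"
proof -
  have "(of_nat (CARD('n) + 1) :: complex) \<noteq> 0" unfolding of_nat_eq_0_iff by simp
  then show ?thesis
    unfolding kernel_inverse_def Let_def
    by (cases i; cases j)
       (auto simp: outer_def ray_component mat_nth intro!: continuous_intros isCont_h_fun_ray)
qed

lemma isCont_obstruction_ray:
  assumes "h_fun \<gamma> (z, w) \<noteq> 0"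
  shows "isCont (\<lambda>t. obstruction \<gamma> (ray t)) 0"
proof -
  have [simp]: "h_fun \<gamma> (ray 0) \<noteq> 0" using assms by (simp add: ray_0)
  show ?thesis
    unfolding obstruction_def Let_def ray_component
    by (intro continuous_intros isCont_h_fun_ray) auto
qed

text \<open>
  Write $\phi_\Gamma = h_1^{-(N+1)} + v$ and $\epsilon = h_1^{N+1}$. Then
  $F_\Gamma = (N+1)^N \epsilon^{-(N+2)} (\det(1 + \epsilon Y) - (1 + \epsilon v)^{N+2})$ with $Y$ regular on
  $h_1 = 0$, and the trace of $Y$ is $(N+2) v$ plus $h_1$ times the sum below. The terms of order
  $\epsilon h_1$ must vanish by themselves because the remainder is of order $\epsilon^2$.
\<close>

lemma boundary_obstruction:
  fixes \<Gamma> :: "(complex^'n^'n) set"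
  assumes "finite \<Gamma>" "mat 1 \<in> \<Gamma>"
    and vanish: "\<And>p. p \<in> regular_points \<Gamma> \<Longrightarrow> F_group \<Gamma> p = 0"
    and h1: "h_fun (mat 1) (z, w) = 0"
    and h\<delta>: "\<And>\<delta>. \<delta> \<in> \<Gamma> - {mat 1} \<Longrightarrow> h_fun \<delta> (z, w) \<noteq> 0"
  shows "(\<Sum>\<delta>\<in>\<Gamma> - {mat 1}. det \<delta> * obstruction \<delta> (z, w)) = 0"
proof -
  let ?G = "\<Gamma> - {mat 1}"
  let ?n = "CARD('n)"
  define e where "e t = t ^ (?n + 1)" for t :: complex
  define v where "v t = (\<Sum>\<delta>\<in>?G. det \<delta> * inverse (h_fun \<delta> (ray t) ^ (?n + 1)))" for t
  define V where "V t = (\<Sum>\<delta>\<in>?G. mat (det \<delta>) ** kernel_block \<delta> (ray t))" for t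
  define Y where "Y t = kernel_inverse (ray t) ** V t" for t
  define E where "E t = (\<Sum>\<delta>\<in>?G. det \<delta> * obstruction \<delta> (ray t))" for t
  have zw: "scalar_product z w = 1" using h1 by (simp add: h_fun_def)
  have h1t: "h_fun (mat 1) (ray t) = t" for t by (simp add: h_fun_ray zw)
  have ne0: "h_fun \<delta> (ray 0) \<noteq> 0" if "\<delta> \<in> ?G" for \<delta>
    using h\<delta>[OF that] by (simp add: ray_0)
  have ev: "eventually (\<lambda>t. \<forall>\<delta>\<in>?G. h_fun \<delta> (ray t) \<noteq> 0) (at 0)"
  proof (intro eventually_ball_finite ballI)
    show "finite ?G" using assms(1) by simp
    show "eventually (\<lambda>t. h_fun \<delta> (ray t) \<noteq> 0) (at 0)" if "\<delta> \<in> ?G" for \<delta>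
      using isCont_h_fun_ray[of \<delta>] ne0[OF that] unfolding isCont_def by (rule tendsto_imp_eventually_ne)
  qed
  have trY: "trace (Y t) = of_nat (?n + 2) * v t + t * E t"
    if "\<forall>\<delta>\<in>?G. h_fun \<delta> (ray t) \<noteq> 0" for t
  proof -
    have "trace (Y t) = (\<Sum>\<delta>\<in>?G. det \<delta> * trace (kernel_inverse (ray t) ** kernel_block \<delta> (ray t)))"
      by (simp add: Y_def V_def matrix_mult_sum_right trace_sum trace_mat_mult matrix_mat_commute)
    also have "\<dots> = (\<Sum>\<delta>\<in>?G. det \<delta> * (of_nat (?n + 2) * inverse (h_fun \<delta> (ray t) ^ (?n + 1))
        + t * obstruction \<delta> (ray t)))"
    proof (intro sum.cong refl)
      fix \<delta> assume "\<delta> \<in> ?G"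
      then have "h_fun \<delta> ((1 - t) *s z, w) \<noteq> 0" using that unfolding ray_def by blast
      from trace_kernel_inverse_mult[OF this] show "det \<delta> * trace (kernel_inverse (ray t) ** kernel_block \<delta> (ray t)) =
          det \<delta> * (of_nat (?n + 2) * inverse (h_fun \<delta> (ray t) ^ (?n + 1)) + t * obstruction \<delta> (ray t))"
        unfolding ray_def[symmetric] h1t by (rule arg_cong)
    qed
    also have "\<dots> = of_nat (?n + 2) * v t + t * E t"
      unfolding v_def E_def sum_distrib_left sum.distrib[symmetric]
      by (intro sum.cong refl) (simp add: algebra_simps)
    finally show ?thesis .
  qed
  have "eventually (\<lambda>t. det (mat 1 + mat (e t) ** Y t) = (1 + e t * v t) ^ (?n + 2)) (at 0)"
    using ev eventually_at_ball'[of 1 0 UNIV, OF zero_less_one]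
  proof eventually_elim
    case (elim t)
    then have t: "t \<noteq> 0" and reg: "ray t \<in> regular_points \<Gamma>"
      using h1t[of t] by (auto simp: regular_points_def)
    have et: "e t \<noteq> 0" using t by (simp add: e_def)
    let ?B = "kernel_block (mat 1) (ray t)"
    have inv: "?B ** (mat (e t) ** kernel_inverse (ray t)) = mat 1"
      using kernel_block_mult_inverse[of "(1 - t) *s z" w] h1t[of t] t by (simp add: ray_def e_def)
    have M: "M_matrix (phi \<Gamma>) (ray t) = ?B ** (mat 1 + mat (e t) ** Y t)"
    proof -
      have "M_matrix (phi \<Gamma>) (ray t) = (\<Sum>\<delta>\<in>\<Gamma>. mat (det \<delta>) ** kernel_block \<delta> (ray t))"
        using M_matrix_phi[OF assms(1)] reg unfolding ray_def by blast
      also have "\<dots> = ?B + V t"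
        unfolding V_def by (subst sum.remove[OF assms(1,2)]) simp
      also have "\<dots> = ?B ** (mat 1 + mat (e t) ** Y t)"
        by (simp add: matrix_add_ldistrib Y_def matrix_mul_assoc inv[unfolded matrix_mul_assoc])
      finally show ?thesis .
    qed
    have phi: "phi \<Gamma> (ray t) = inverse (e t) * (1 + e t * v t)"
    proof -
      have "phi \<Gamma> (ray t) = inverse (e t) + v t"
        unfolding phi_def v_def by (subst sum.remove[OF assms(1,2)]) (simp add: h1t e_def)
      then show ?thesis using et by (simp add: field_simps)
    qed
    have C: "(of_nat ((?n + 1) ^ ?n) :: complex) \<noteq> 0"
      unfolding of_nat_eq_0_iff by simp
    have "det ?B = of_nat ((?n + 1) ^ ?n) * inverse (e t) ^ (?n + 2)"
      using det_kernel_block_one[of "(1 - t) *s z" w] h1t[of t] t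
      unfolding ray_def[symmetric] by (simp only: e_def power_inverse power_mult not_False_eq_True simp_thms)
    moreover have "det (M_matrix (phi \<Gamma>) (ray t)) - of_nat ((?n + 1) ^ ?n) * phi \<Gamma> (ray t) ^ (?n + 2) = 0"
      using vanish[OF reg] by (simp only: F_group_def F_op_def)
    ultimately have "of_nat ((?n + 1) ^ ?n) * inverse (e t) ^ (?n + 2) *
        (det (mat 1 + mat (e t) ** Y t) - (1 + e t * v t) ^ (?n + 2)) = 0"
      unfolding M phi det_mul power_mult_distrib by (simp only: right_diff_distrib mult.assoc)
    then show ?case using C et by simp
  qed
  note det_eq = this
  have Y_bigo: "(\<lambda>t. Y t $ i $ j) \<in> O[at 0](\<lambda>_. 1)" for i j
  proof -
    have "isCont (\<lambda>t. Y t $ i $ j) 0"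
      unfolding Y_def V_def matrix_matrix_mult_def[of "kernel_inverse _"] vec_lambda_beta sum_component mat_mult_nth
      by (intro continuous_intros isCont_kernel_inverse_ray isCont_kernel_block_ray h\<delta>)
    then show ?thesis by (rule isCont_imp_bigo_1)
  qed
  have v_bigo: "v \<in> O[at 0](\<lambda>_. 1)"
    unfolding v_def using ne0 by (intro isCont_imp_bigo_1 continuous_intros isCont_h_fun_ray) auto
  have e_bigo: "e \<in> O[at 0](\<lambda>_. 1)"
    unfolding e_def by (intro isCont_imp_bigo_1 continuous_intros)
  have A1: "(\<lambda>t. det (mat 1 + mat (e t) ** Y t) - 1 - e t * trace (Y t)) \<in> O[at 0](\<lambda>t. e t ^ 2)"
    by (rule det_first_order[OF Y_bigo e_bigo])
  have A2: "(\<lambda>t. (1 + e t * v t) ^ (?n + 2) - 1 - e t * (of_nat (?n + 2) * v t)) \<in> O[at 0](\<lambda>t. e t ^ 2)"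
    using prod_first_order[of "{..<?n + 2}" "\<lambda>_. v", OF _ v_bigo e_bigo] by simp
  have "eventually (\<lambda>t. ((1 + e t * v t) ^ (?n + 2) - 1 - e t * (of_nat (?n + 2) * v t))
     - (det (mat 1 + mat (e t) ** Y t) - 1 - e t * trace (Y t)) = e t * (t * E t)) (at 0)"
    using ev det_eq by eventually_elim (simp add: trY algebra_simps)
  then have "(\<lambda>t. e t * (t * E t)) \<in> O[at 0](\<lambda>t. e t ^ 2)"
    using sum_in_bigo(2)[OF A2 A1] landau_o.big.in_cong by fast
  then obtain c where c: "c > 0" "eventually (\<lambda>t. norm (e t * (t * E t)) \<le> c * norm (e t ^ 2)) (at 0)"
    by (rule landau_o.bigE)
  have "eventually (\<lambda>t. norm (E t) \<le> c * norm (t ^ ?n)) (at 0)"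
    using c(2) eventually_at_ball'[of 1 0 UNIV, OF zero_less_one]
  proof eventually_elim
    case (elim t)
    then have "norm (t ^ (?n + 2)) * norm (E t) \<le> norm (t ^ (?n + 2)) * (c * norm (t ^ ?n))"
      by (simp add: e_def norm_mult norm_power power2_eq_square mult_ac)
    with elim show ?case by (subst (asm) mult_le_cancel_left_pos) auto
  qed
  moreover have "((\<lambda>t::complex. c * norm (t ^ ?n)) \<longlongrightarrow> c * norm ((0::complex) ^ ?n)) (at 0)"
    by (intro tendsto_intros)
  then have "((\<lambda>t::complex. c * norm (t ^ ?n)) \<longlongrightarrow> 0) (at 0)"
    by (simp add: power_0_left)
  ultimately have lim0: "(E \<longlongrightarrow> 0) (at 0)"
    by (rule Lim_null_comparison)
  have lim: "(E \<longlongrightarrow> E 0) (at 0)"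
    unfolding isCont_def[symmetric] unfolding E_def
    by (intro continuous_intros isCont_obstruction_ray h\<delta>)
  have "E 0 = 0" using tendsto_unique[OF _ lim lim0] by simp
  then show ?thesis by (simp add: E_def ray_0)
qed

end

text \<open>
  On $h_1 = 0$, near an isolated double zero, the obstruction of \<open>\<gamma>\<close> has a pole along
  $h_\gamma = 0$ with leading coefficient proportional to $z^T\gamma^2 w - 1 \neq 0$, while all other terms stay
  bounded. Hence the sum of the obstructions does not vanish identically.
\<close>

lemma F_group_nonzero_if_nonscalar_element:
  fixes \<Gamma> :: "(complex^'n^'n) set"
  assumes "finite \<Gamma>" "mat 1 \<in> \<Gamma>" and unitary: "\<And>\<delta>. \<delta> \<in> \<Gamma> \<Longrightarrow> unitary_matrix \<delta>"
    and "fixed_point_free \<Gamma>" and \<gamma>: "\<gamma> \<in> \<Gamma>" and nonscalar: "\<And>a. \<gamma> \<noteq> mat a"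
  shows "\<exists>p\<in>regular_points \<Gamma>. F_group \<Gamma> p \<noteq> 0"
proof (rule ccontr)
  assume "\<not> ?thesis"
  then have vanish: "\<And>p. p \<in> regular_points \<Gamma> \<Longrightarrow> F_group \<Gamma> p = 0" by blast
  let ?n = "CARD('n)"
  obtain z w d where zw: "h_fun (mat 1) (z, w) = 0" "h_fun \<gamma> (z, w) = 0"
    "scalar_product z (\<gamma> *v (\<gamma> *v w)) \<noteq> 1"
    and others: "\<And>\<delta>. \<delta> \<in> \<Gamma> - {mat 1, \<gamma>} \<Longrightarrow> h_fun \<delta> (z, w) \<noteq> 0"
    and d: "scalar_product d w = 0" "scalar_product d (\<gamma> *v w) \<noteq> 0"
    using isolated_double_zero[OF \<open>finite \<Gamma>\<close> unitary \<open>fixed_point_free \<Gamma>\<close> \<gamma> nonscalar] by metis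
  let ?G = "\<Gamma> - {mat 1, \<gamma>}"
  define p where "p t = (z + t *s d, w)" for t
  define b where "b = scalar_product d (\<gamma> *v w)"
  have h: "h_fun \<delta> (p t) = h_fun \<delta> (z, w) - t * scalar_product d (\<delta> *v w)" for \<delta> t
    by (simp add: h_fun_def p_def scalar_product_add_left)
  have cont_h: "isCont (\<lambda>t. h_fun \<delta> (p t)) 0" for \<delta>
    unfolding h by (intro continuous_intros)
  have p0: "p 0 = (z, w)" by (simp add: p_def)
  have h1: "h_fun (mat 1) (p t) = 0" and h\<gamma>: "h_fun \<gamma> (p t) = - t * b" for t
    using zw d by (simp_all add: h b_def)
  have b: "b \<noteq> 0" using d by (simp add: b_def)
  have ev: "eventually (\<lambda>t. \<forall>\<delta>\<in>?G. h_fun \<delta> (p t) \<noteq> 0) (at 0)"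
  proof (intro eventually_ball_finite ballI)
    show "finite ?G" using assms(1) by simp
    show "eventually (\<lambda>t. h_fun \<delta> (p t) \<noteq> 0) (at 0)" if "\<delta> \<in> ?G" for \<delta>
      using cont_h[of \<delta>] others[OF that] unfolding isCont_def p0 by (rule tendsto_imp_eventually_ne)
  qed
  define R where "R t = (\<Sum>\<delta>\<in>?G. det \<delta> * obstruction \<delta> (p t))" for t
  \<comment> \<open>The sum of the obstructions, cleared of its pole at $t = 0$.\<close>
  define L where "L t = det \<gamma> * (of_nat (?n + 2) * (scalar_product (z + t *s d) (\<gamma> *v (\<gamma> *v w)) - 1)
     + (trace \<gamma> + 1) * (- t * b)) + (- t * b) ^ (?n + 3) * R t" for t
  have "eventually (\<lambda>t. L t = 0) (at 0)"
    using ev eventually_at_ball'[of 1 0 UNIV, OF zero_less_one]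
  proof eventually_elim
    case (elim t)
    then have k: "- t * b \<noteq> 0" using b by auto
    have "(\<Sum>\<delta>\<in>\<Gamma> - {mat 1}. det \<delta> * obstruction \<delta> (p t)) = 0"
      unfolding p_def
    proof (rule boundary_obstruction[OF \<open>finite \<Gamma>\<close> \<open>mat 1 \<in> \<Gamma>\<close> vanish])
      show "h_fun (mat 1) (z + t *s d, w) = 0" using h1[of t] by (simp add: p_def)
      show "h_fun \<delta> (z + t *s d, w) \<noteq> 0" if "\<delta> \<in> \<Gamma> - {mat 1}" for \<delta>
        using elim that k h\<gamma>[of t] by (cases "\<delta> = \<gamma>") (auto simp: p_def)
    qed
    moreover have "\<Gamma> - {mat 1} - {\<gamma>} = ?G" by auto
    ultimately have "det \<gamma> * obstruction \<gamma> (p t) + R t = 0"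
      unfolding R_def using \<gamma> nonscalar[of 1] \<open>finite \<Gamma>\<close> by (subst (asm) sum.remove[of _ \<gamma>]) auto
    moreover have "(- t * b) ^ (?n + 3) * obstruction \<gamma> (p t) =
       of_nat (?n + 2) * (scalar_product (z + t *s d) (\<gamma> *v (\<gamma> *v w)) - 1) + (trace \<gamma> + 1) * (- t * b)"
    proof -
      define k where "k = - t * b"
      have "k \<noteq> 0" using \<open>- t * b \<noteq> 0\<close> by (simp add: k_def)
      have e: "k ^ (?n + 3) = k * k ^ (?n + 2)" by (simp add: numeral_3_eq_3)
      have "k ^ (?n + 3) * obstruction \<gamma> (p t) = 
        of_nat (?n + 2) * (scalar_product (z + t *s d) (\<gamma> *v (\<gamma> *v w)) - 1) * (k ^ (?n + 3) * inverse (k ^ (?n + 3)))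
        + (trace \<gamma> + 1) * (k * (k ^ (?n + 2) * inverse (k ^ (?n + 2))))"
        unfolding obstruction_def Let_def h\<gamma> k_def[symmetric] e by (simp add: p_def ring_distribs mult_ac)
      also have "k ^ (?n + 3) * inverse (k ^ (?n + 3)) = 1" using \<open>k \<noteq> 0\<close> by (intro right_inverse) simp
      also have "k ^ (?n + 2) * inverse (k ^ (?n + 2)) = 1" using \<open>k \<noteq> 0\<close> by (intro right_inverse) simp
      finally show ?thesis by (simp add: k_def)
    qed
    ultimately have "L t = (- t * b) ^ (?n + 3) * (det \<gamma> * obstruction \<gamma> (p t) + R t)"
      unfolding L_def by (metis (no_types, lifting) distrib_left mult.left_commute)
    with \<open>det \<gamma> * obstruction \<gamma> (p t) + R t = 0\<close> show ?case by simp
  qed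
  then have lim0: "(L \<longlongrightarrow> 0) (at 0)" by (rule tendsto_eventually)
  have "isCont R 0"
  proof -
    have "isCont (\<lambda>t. obstruction \<delta> (p t)) 0" if "\<delta> \<in> ?G" for \<delta>
    proof -
      have "isCont (\<lambda>t. of_nat (?n + 2) * (scalar_product z (\<delta> *v (\<delta> *v w)) + t * scalar_product d (\<delta> *v (\<delta> *v w)) - 1)
           * inverse (h_fun \<delta> (p t) ^ (?n + 3)) + (trace \<delta> + 1) * inverse (h_fun \<delta> (p t) ^ (?n + 2))) 0"
        using others[OF that] by (intro continuous_intros cont_h) (auto simp: p0)
      then show ?thesis
        unfolding obstruction_def Let_def by (simp add: p_def scalar_product_add_left)
    qed
    then show ?thesis unfolding R_def by (intro continuous_intros)
  qed
  then have "isCont L 0"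
    unfolding L_def scalar_product_add_left scalar_product_scale by (intro continuous_intros)
  then have lim: "(L \<longlongrightarrow> L 0) (at 0)" by (simp add: isCont_def)
  have "L 0 = 0" using tendsto_unique[OF _ lim lim0] by simp
  moreover have "det \<gamma> \<noteq> 0"
  proof
    assume "det \<gamma> = 0"
    then have "det (conj_transpose \<gamma> ** \<gamma>) = 0" by (simp add: det_mul)
    with unitary[OF \<gamma>] show False by (simp add: unitary_matrix_def)
  qed
  moreover have "(of_nat (?n + 2) :: complex) \<noteq> 0" unfolding of_nat_eq_0_iff by simp
  ultimately show False using zw(3) by (simp add: L_def power_0_left)
qed

section \<open>The leading coefficients of a radial solution\<close>

lemma two_mult_power_le: "m ^ j * (m + j) \<le> m * (m + 1) ^ j" for m :: nat
proof (induction j)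
  case (Suc j)
  have "m ^ Suc j * (m + Suc j) \<le> (m + 1) * (m ^ j * (m + j))"
    by (simp add: algebra_simps)
  also have "\<dots> \<le> (m + 1) * (m * (m + 1) ^ j)"
    using Suc by (rule mult_left_mono) simp
  finally show ?case by (simp add: mult_ac)
qed simp

lemma two_power_fact_le: "2 ^ n * fact n \<le> (n + 1) ^ n" for n :: nat
proof (induction n)
  case (Suc n)
  have "(n + 1) * (2 * (n + 1) ^ (n + 1)) \<le> (n + 1) * (n + 2) ^ (n + 1)"
    using two_mult_power_le[of "n + 1" "n + 1"] by (simp add: algebra_simps)
  then have *: "2 * (n + 1) ^ (n + 1) \<le> (n + 2) ^ (n + 1)"
    by (subst (asm) mult_le_cancel1) simp
  have "2 ^ Suc n * fact (Suc n) = 2 * (n + 1) * (2 ^ n * fact n)"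
    by (simp add: algebra_simps)
  also have "\<dots> \<le> 2 * (n + 1) * (n + 1) ^ n"
    using Suc by (rule mult_left_mono) simp
  also have "\<dots> \<le> (n + 2) ^ (n + 1)" using * by (simp add: mult_ac)
  finally show ?case by (simp add: numeral_2_eq_2)
qed simp

lemma fact_times_binomial: "fact n * ((m + n) choose n) = (\<Prod>j=1..n. m + j)" for m n :: nat
proof (induction n)
  case (Suc n)
  have "fact (Suc n) * ((m + Suc n) choose Suc n) = fact n * (Suc n * (Suc (m + n) choose Suc n))"
    by (simp only: fact_Suc of_nat_id mult_ac add_Suc_right)
  also have "\<dots> = Suc (m + n) * (fact n * ((m + n) choose n))"
    using Suc_times_binomial_eq[of "m + n" n] by (metis mult.assoc mult.commute)
  also have "\<dots> = (\<Prod>j=1..Suc n. m + j)" unfolding Suc by (simp add: mult_ac)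
  finally show ?case .
qed simp

text \<open>
  After multiplication by the square of $n!$ and removal of the common factors $(n+k)^2$, this
  follows from $k(n + 2k + j) < 2(k+j)(k+n-j)$ for $0 < j < n$ and from $2^n n! \le (n+1)^n$.
\<close>

lemma binomial_inequality:
  fixes n k :: nat
  assumes "n \<ge> 2" "k \<ge> 1"
  shows "k ^ (n - 1) * (n + k) * ((2 * (n + k)) choose n) < (n + 1) ^ n * ((n + k) choose n)\<^sup>2"
proof -
  obtain m where m: "n = Suc m" "m \<ge> 1" using assms by (cases n) auto
  let ?P = "\<Prod>j=1..m. k + j"
  \<comment> \<open>Pairing the index $j$ with $n - j$ turns the product below into a square.\<close>
  have refl: "(\<Prod>j=1..m. k + n - j) = ?P"
    by (rule prod.reindex_bij_witness[of _ "\<lambda>j. n - j" "\<lambda>j. n - j"]) (auto simp: m)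
  have "k ^ m * (\<Prod>j=1..m. n + 2 * k + j) = (\<Prod>j=1..m. k * (n + 2 * k + j))"
    by (simp add: prod.distrib)
  also have "\<dots> < (\<Prod>j=1..m. 2 * ((k + j) * (k + n - j)))"
  proof -
    have "k * (n + 2 * k + j) < 2 * ((k + j) * (k + n - j))" if "j \<in> {1..m}" for j
    proof -
      obtain i where i: "n = j + Suc i" using \<open>j \<in> {1..m}\<close> m less_iff_Suc_add[of j n] by auto
      have "k * (n + 2 * k + j) < 2 * ((k + j) * (k + Suc i))"
        using i assms(2) that by (simp add: algebra_simps)
      then show ?thesis using i by simp
    qed
    note less = this
    show ?thesis
    proof (rule prod_mono_strict[of 1])
      show "1 \<in> {1..m}" using m(2) by simp
      then show "k * (n + 2 * k + 1) < 2 * ((k + 1) * (k + n - 1))" by (rule less)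
      show "0 \<le> k * (n + 2 * k + j) \<and> k * (n + 2 * k + j) \<le> 2 * ((k + j) * (k + n - j))"
        if "j \<in> {1..m}" for j
        using less[OF that] by simp
      show "0 < 2 * ((k + j) * (k + n - j))" if "j \<in> {1..m}" for j
        by (rule le_less_trans[OF _ less[OF that]]) simp
    qed simp
  qed
  also have "\<dots> = 2 ^ m * ?P\<^sup>2"
    unfolding prod.distrib refl power2_eq_square by (simp add: mult_ac)
  finally have 1: "k ^ m * (\<Prod>j=1..m. n + 2 * k + j) < 2 ^ m * ?P\<^sup>2" .
  have a: "fact n * ((2 * (n + k)) choose n) = (\<Prod>j=1..m. n + 2 * k + j) * (2 * (n + k))"
    using fact_times_binomial[of n "n + 2 * k"] by (simp add: m algebra_simps)
  have b: "fact n * ((n + k) choose n) = ?P * (n + k)"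
    using fact_times_binomial[of n k] by (simp add: m algebra_simps)
  have "(fact n)\<^sup>2 * (k ^ (n - 1) * (n + k) * ((2 * (n + k)) choose n))
      = fact n * k ^ m * (n + k) * (fact n * ((2 * (n + k)) choose n))"
    using m(1) by (simp only: power2_eq_square mult_ac diff_Suc_1)
  also have "\<dots> = 2 * fact n * (n + k)\<^sup>2 * (k ^ m * (\<Prod>j=1..m. n + 2 * k + j))"
    unfolding a by (simp only: power2_eq_square mult_ac)
  also have "\<dots> < 2 * fact n * (n + k)\<^sup>2 * (2 ^ m * ?P\<^sup>2)"
    using 1 assms by (intro mult_strict_left_mono) auto
  also have "\<dots> = (2 ^ n * fact n) * (?P * (n + k))\<^sup>2"
    using m(1) by (simp only: power2_eq_square power_Suc mult_ac)
  also have "\<dots> \<le> (n + 1) ^ n * (?P * (n + k))\<^sup>2"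
    by (intro mult_right_mono two_power_fact_le) simp
  also have "\<dots> = (fact n)\<^sup>2 * ((n + 1) ^ n * ((n + k) choose n)\<^sup>2)"
    unfolding b[symmetric] by (simp add: power_mult_distrib)
  finally show ?thesis by simp
qed

text \<open>
  The equation $F = 0$ for a function $g(z^T w)$, where $g$ has the expansion
  $a t^k + b t^{k+e} + \ldots$ The monomial $a t^k$ alone contributes nothing to the second factor on the left,
  whose first nonzero term is $e^2 a b\, t^{2k+e-1}$. Comparing orders and leading
  coefficients of both sides gives the two equations.
\<close>

lemma fps_leading_terms:
  fixes G :: "complex fps"
  assumes n: "n \<ge> 1" and k: "k \<ge> 1" and e: "e \<ge> 1"
    and a: "fps_nth G k \<noteq> 0" and b: "fps_nth G (k + e) \<noteq> 0" and C: "C \<noteq> 0"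
    and gap: "\<And>i. i < k + e \<Longrightarrow> i \<noteq> k \<Longrightarrow> fps_nth G i = 0"
    and eq: "fps_deriv G ^ (n - 1) *
        (G * fps_deriv G + fps_X * (fps_deriv (fps_deriv G) * G - (fps_deriv G)\<^sup>2)) = fps_const C * G ^ (n + 2)"
  shows "e = n + k \<and>
    of_nat k ^ (n - 1) * fps_nth G (k + e) * of_nat e ^ 2 = C * fps_nth G k ^ 2"
proof -
  define T where "T = fps_X * fps_deriv G"
  define U where "U = fps_X * fps_deriv T"
  define H where "H = G * U - T * T"
  have T: "fps_nth T i = of_nat i * fps_nth G i" for i
    by (cases i) (simp_all add: T_def)
  have U: "fps_nth U i = of_nat i ^ 2 * fps_nth G i" for i
    by (cases i) (simp_all add: U_def T power2_eq_square)
  have H: "fps_nth H m = (\<Sum>i=0..m. of_nat (m - i) * (of_nat (m - i) - of_nat i) * (fps_nth G i * fps_nth G (m - i)))" for m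
    unfolding H_def fps_sub_nth fps_mult_nth T U sum_subtractf[symmetric]
    by (intro sum.cong refl) (simp add: power2_eq_square algebra_simps)
  have "H = fps_X * (G * fps_deriv G + fps_X * (fps_deriv (fps_deriv G) * G - (fps_deriv G)\<^sup>2))"
    by (simp add: H_def U_def T_def power2_eq_square algebra_simps)
  moreover have "fps_X ^ n = fps_X * (fps_X :: complex fps) ^ (n - 1)"
    using n by (cases n) auto
  ultimately have main: "T ^ (n - 1) * H = fps_const C * (fps_X ^ n * G ^ (n + 2))"
    using arg_cong[OF eq, of "\<lambda>x. fps_X ^ n * x"]
    by (simp add: T_def power_mult_distrib mult_ac)
  have low: "fps_nth G i \<noteq> 0 \<Longrightarrow> i = k \<or> i \<ge> k + e" for i
    using gap by (meson not_le)
  have sG: "subdegree G = k"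
    using a gap e by (intro subdegreeI) auto
  have sT: "subdegree T = k"
    using a gap e k by (intro subdegreeI) (auto simp: T)
  \<comment> \<open>The coefficient carries the factor $m - 2i$, which is zero when both indices equal $k$.\<close>
  have H0: "fps_nth H m = 0" if "m < 2 * k + e" for m
  proof -
    have "of_nat (m - i) * (of_nat (m - i) - of_nat i) * (fps_nth G i * fps_nth G (m - i)) = 0" if "i \<le> m" for i
    proof (rule ccontr)
      assume "\<not> ?thesis"
      then have "m - i \<noteq> i" "fps_nth G i \<noteq> 0" "fps_nth G (m - i) \<noteq> 0" by auto
      with low[of i] low[of "m - i"] \<open>m < 2 * k + e\<close> that show False by linarith
    qed
    then show ?thesis unfolding H by (intro sum.neutral) auto
  qed
  have Hlead: "fps_nth H (2 * k + e) = of_nat e ^ 2 * fps_nth G k * fps_nth G (k + e)"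
  proof -
    let ?m = "2 * k + e"
    let ?f = "\<lambda>i. of_nat (?m - i) * (of_nat (?m - i) - of_nat i) * (fps_nth G i * fps_nth G (?m - i))"
    have "fps_nth H ?m = sum ?f {k, k + e}"
      unfolding H
    proof (rule sum.mono_neutral_right)
      show "\<forall>i\<in>{0..?m} - {k, k + e}. ?f i = 0"
      proof
        fix i assume "i \<in> {0..?m} - {k, k + e}"
        then have i: "i \<le> ?m" "i \<noteq> k" "i \<noteq> k + e" by auto
        show "?f i = 0"
        proof (rule ccontr)
          assume "?f i \<noteq> 0"
          then have "fps_nth G i \<noteq> 0" "fps_nth G (?m - i) \<noteq> 0" by auto
          with low[of i] low[of "?m - i"] i show False by linarith
        qed
      qed
    qed auto
    also have "\<dots> = of_nat e ^ 2 * fps_nth G k * fps_nth G (k + e)"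
      using e by (simp add: algebra_simps power2_eq_square of_nat_diff)
    finally show ?thesis .
  qed
  have sH: "subdegree H = 2 * k + e"
    using H0 Hlead a b e by (intro subdegreeI) auto
  have nz: "T \<noteq> 0" "H \<noteq> 0" "G \<noteq> 0"
    using k e sT sH sG by auto
  have "subdegree (T ^ (n - 1) * H) = (n - 1) * k + (2 * k + e)"
    using nz by (simp add: sT sH)
  moreover have "subdegree (fps_const C * (fps_X ^ n * G ^ (n + 2))) = n + (n + 2) * k"
    using nz C by (subst subdegree_mult) (simp_all add: sG)
  ultimately have deg: "(n - 1) * k + (2 * k + e) = n + (n + 2) * k"
    unfolding main by simp
  then have e_eq: "e = n + k" using n by (cases n) (auto simp: algebra_simps)
  have lead1: "fps_nth (T ^ (n - 1) * H) ((n - 1) * k + (2 * k + e)) = (of_nat k * fps_nth G k) ^ (n - 1) * fps_nth H (2 * k + e)"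
    using nth_subdegree_mult[of "T ^ (n - 1)" H] fps_pow_base[of T "n - 1"] by (simp add: sT sH T)
  have lead2: "fps_nth (fps_const C * (fps_X ^ n * G ^ (n + 2))) (n + (n + 2) * k) = C * fps_nth G k ^ (n + 2)"
    using nth_subdegree_mult[of "fps_X ^ n" "G ^ (n + 2)"] fps_pow_base[of G "n + 2"]
    unfolding subdegree_power sG fps_X_power_subdegree fps_mult_left_const_nth by simp
  have lead: "(of_nat k * fps_nth G k) ^ (n - 1) * (of_nat e ^ 2 * fps_nth G k * fps_nth G (k + e)) = C * fps_nth G k ^ (n + 2)"
    using lead1 lead2 unfolding main deg Hlead by (simp only:)
  have split: "fps_nth G k ^ (n + 2) = fps_nth G k ^ (n - 1) * fps_nth G k * fps_nth G k ^ 2"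
    using n by (cases n) (simp_all add: power2_eq_square)
  have "(fps_nth G k ^ (n - 1) * fps_nth G k) * (of_nat k ^ (n - 1) * fps_nth G (k + e) * of_nat e ^ 2)
      = (fps_nth G k ^ (n - 1) * fps_nth G k) * (C * fps_nth G k ^ 2)"
    using lead unfolding split power_mult_distrib by (simp only: mult_ac)
  then show ?thesis using a e_eq by simp
qed

section \<open>Groups of scalar matrices\<close>

lemma nth_inverse_one_minus_power:
  "fps_nth (inverse ((1 - fps_const c * fps_X) ^ Suc m)) k = of_nat ((m + k) choose k) * (c :: complex) ^ k"
proof -
  have neg: "- fps_const c * fps_X = fps_const (- c) * fps_X" by simp
  then have "fps_nth (inverse ((1 - fps_const c * fps_X) ^ Suc m)) k = (- c) ^ k * (- of_nat (Suc m) gchoose k)"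
    unfolding one_minus_fps_X_const_neg_power neg fps_nth_compose_linear by (simp add: fps_binomial_def)
  also have "- of_nat (Suc m) gchoose k = (-1) ^ k * (of_nat (m + k) gchoose k :: complex)"
    by (subst gbinomial_minus) simp
  also have "(- c) ^ k * ((-1) ^ k * (of_nat (m + k) gchoose k)) = of_nat ((m + k) choose k) * c ^ k"
    by (simp add: binomial_gbinomial power_mult_distrib[symmetric] mult.assoc[symmetric])
  finally show ?thesis .
qed

lemma has_fps_expansion_power:
  fixes f :: "complex \<Rightarrow> complex"
  assumes "f has_fps_expansion F"
  shows "(\<lambda>x. f x ^ m) has_fps_expansion F ^ m"
  by (induction m) (auto intro!: has_fps_expansion_mult assms)

text \<open>
  When all elements of the group are scalars, \<open>root_sum Z N 0\<close> at $t = z^T w$ is $\phi_\Gamma$, and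
  its derivatives are multiples of the functions with \<open>p = 1\<close> and \<open>p = 2\<close>.
\<close>

definition root_sum :: "complex set \<Rightarrow> nat \<Rightarrow> nat \<Rightarrow> complex \<Rightarrow> complex"
  where "root_sum Z m p t = (\<Sum>c\<in>Z. c ^ (m + p) * inverse ((1 - c * t) ^ Suc (m + p)))"

definition root_fps :: "complex set \<Rightarrow> nat \<Rightarrow> nat \<Rightarrow> complex fps"
  where "root_fps Z m p = (\<Sum>c\<in>Z. fps_const (c ^ (m + p)) * inverse ((1 - fps_const c * fps_X) ^ Suc (m + p)))"

lemma root_sum_has_fps_expansion: "root_sum Z m p has_fps_expansion root_fps Z m p"
  unfolding root_sum_def[abs_def] root_fps_def
  by (intro fps_expansion_intros has_fps_expansion_power) (simp_all add: fps_power_zeroth)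

lemma nth_root_fps: "fps_nth (root_fps Z m p) k = of_nat ((m + p + k) choose k) * (\<Sum>c\<in>Z. c ^ (m + p + k))"
  unfolding root_fps_def fps_sum_nth fps_mult_left_const_nth nth_inverse_one_minus_power sum_distrib_left
  by (intro sum.cong refl) (simp add: power_add mult_ac)

lemma fps_deriv_root_fps: "fps_deriv (root_fps Z m p) = fps_const (of_nat (m + p + 1)) * root_fps Z m (p + 1)"
proof (rule fps_ext)
  fix k
  have "Suc k * (Suc (m + p + k) choose Suc k) = Suc (m + p) * (Suc (m + p + k) choose k)"
    using Suc_times_binomial_add[of "k" "m + p"] by (simp add: add_ac)
  then have "of_nat (Suc k) * of_nat (Suc (m + p + k) choose Suc k) = (of_nat (Suc (m + p)) * of_nat (Suc (m + p + k) choose k) :: complex)"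
    by (simp only: of_nat_mult[symmetric])
  then show "fps_nth (fps_deriv (root_fps Z m p)) k = fps_nth (fps_const (of_nat (m + p + 1)) * root_fps Z m (p + 1)) k"
    by (simp add: nth_root_fps mult.assoc[symmetric] del: binomial_Suc_Suc of_nat_Suc)
qed

text \<open>
  The case $b = 0$ occurs where the derivative of $g$ vanishes. There some row is zero, because
  there are at least two coordinates.
\<close>

lemma det_bordered_rank_one_axis:
  fixes i :: "'n::finite"
  assumes "CARD('n) \<ge> 2" and z: "z = t *s axis i 1" and w: "w = axis i 1"
  shows "det (bordered a (b *s z) (b *s w) (outer (c *s w) z + mat b)) =
    b ^ (CARD('n) - 1) * (a * b - t * (b\<^sup>2 - c * a))"
proof (cases "b = 0")
  case False
  have "scalar_product z w = t" unfolding z w by (simp add: scalar_product_axis_left; simp add: axis_def)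
  with False show ?thesis by (simp add: det_bordered_rank_one)
next
  case True
  have "\<exists>j. j \<noteq> i"
  proof (rule ccontr)
    assume "\<nexists>j. j \<noteq> i"
    then have "(UNIV :: 'n set) = {i}" by auto
    then have "CARD('n) = card {i}" by (rule arg_cong)
    with assms(1) show False by simp
  qed
  then obtain j where "j \<noteq> i" by blast
  let ?M = "bordered a (b *s z) (b *s w) (outer (c *s w) z + mat b)"
  have "?M $ Some j $ l = 0" for l
    using True \<open>j \<noteq> i\<close> by (cases l) (simp_all add: w outer_def axis_def mat_nth)
  then have "row (Some j) ?M = 0" by (simp add: row_def vec_eq_iff)
  then have "det ?M = 0" by (rule det_zero_row)
  then show ?thesis using True assms(1) by simp
qed

lemma det_mat: "det (mat c :: complex^'n^'n) = c ^ CARD('n)"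
  by (subst det_diagonal) (simp_all add: mat_nth)

lemma inj_mat: "inj (mat :: complex \<Rightarrow> complex^'n^'n)"
  by (rule injI) (metis mat_nth)

lemma F_group_scalar:
  fixes i :: "'n::finite" and Z :: "complex set"
  assumes "CARD('n) \<ge> 2" "finite Z" and nz: "\<And>c. c \<in> Z \<Longrightarrow> 1 - c * t \<noteq> 0"
  defines "p \<equiv> (t *s axis i 1, axis i 1 :: complex^'n)"
    and "g \<equiv> root_sum Z CARD('n)"
    and "s \<equiv> of_nat (CARD('n) + 1)" and "s' \<equiv> of_nat (CARD('n) + 2)"
  shows "p \<in> regular_points (mat ` Z)"
    and "F_group (mat ` Z) p = (s * g 1 t) ^ (CARD('n) - 1) *
      (g 0 t * (s * g 1 t) + t * (s * s' * g 2 t * g 0 t - (s * g 1 t)\<^sup>2))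
      - s ^ CARD('n) * g 0 t ^ (CARD('n) + 2)"
proof -
  define z :: "complex^'n" where "z = t *s axis i 1"
  define w :: "complex^'n" where "w = axis i 1"
  have p: "p = (z, w)" by (simp add: p_def z_def w_def)
  have "scalar_product z w = t"
    unfolding z_def w_def by (simp add: scalar_product_axis_left; simp add: axis_def)
  define k where "k c = 1 - c * t" for c
  have h: "h_fun (mat c) p = k c" for c
    using \<open>scalar_product z w = t\<close> by (simp add: p h_fun_def k_def)
  have g: "g q t = (\<Sum>c\<in>Z. c ^ (CARD('n) + q) * inverse (k c ^ (CARD('n) + 1 + q)))" for q
    by (simp add: g_def root_sum_def k_def)
  show reg: "p \<in> regular_points (mat ` Z)"
    using nz by (auto simp: regular_points_def h k_def)
  have inj: "inj_on (mat :: complex \<Rightarrow> complex^'n^'n) Z" using inj_mat by (rule inj_on_subset) simp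
  have phi: "phi (mat ` Z) p = g 0 t"
    by (simp add: phi_def sum.reindex[OF inj] h det_mat g)
  have "M_matrix (phi (mat ` Z)) p = (\<Sum>\<gamma>\<in>mat ` Z. mat (det \<gamma>) ** kernel_block \<gamma> (z, w))"
    using reg \<open>finite Z\<close> unfolding p by (intro M_matrix_phi) auto
  also have "\<dots> = (\<Sum>c\<in>Z. mat (c ^ CARD('n)) ** kernel_block (mat c) (z, w))"
    by (simp add: sum.reindex[OF inj] det_mat)
  also have "\<dots> = bordered (g 0 t) ((s * g 1 t) *s z) ((s * g 1 t) *s w)
      (outer ((s * s' * g 2 t) *s w) z + mat (s * g 1 t))"
    by (rule option_matrix_eqI)
       (simp_all add: kernel_block_def Let_def h[unfolded p] g s_def s'_def outer_def mat_nth
          sum_distrib_left sum_distrib_right power2_eq_square numeral_3_eq_3 mult_ac ring_distribs sum.distrib)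
  finally have M: "M_matrix (phi (mat ` Z)) p = bordered (g 0 t) ((s * g 1 t) *s z) ((s * g 1 t) *s w)
      (outer ((s * s' * g 2 t) *s w) z + mat (s * g 1 t))" .
  have "F_group (mat ` Z) p = det (M_matrix (phi (mat ` Z)) p) - s ^ CARD('n) * phi (mat ` Z) p ^ (CARD('n) + 2)"
    by (simp only: F_group_def F_op_def s_def of_nat_power)
  then show "F_group (mat ` Z) p = (s * g 1 t) ^ (CARD('n) - 1) *
      (g 0 t * (s * g 1 t) + t * (s * s' * g 2 t * g 0 t - (s * g 1 t)\<^sup>2))
      - s ^ CARD('n) * g 0 t ^ (CARD('n) + 2)"
    unfolding M phi det_bordered_rank_one_axis[OF assms(1) z_def w_def]
    by (simp add: algebra_simps)
qed

lemma root_fps_equation: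
  fixes Z :: "complex set"
  assumes "CARD('n::finite) \<ge> 2" "finite Z"
    and vanish: "\<And>p. p \<in> regular_points (mat ` Z :: (complex^'n^'n) set) \<Longrightarrow> F_group (mat ` Z) p = 0"
  defines "G \<equiv> root_fps Z CARD('n) 0"
  shows "fps_deriv G ^ (CARD('n) - 1) *
        (G * fps_deriv G + fps_X * (fps_deriv (fps_deriv G) * G - (fps_deriv G)\<^sup>2))
     = fps_const (of_nat (CARD('n) + 1) ^ CARD('n)) * G ^ (CARD('n) + 2)"
proof -
  define g where "g = root_sum Z CARD('n)"
  define R where "R = root_fps Z CARD('n)"
  define s :: complex where "s = of_nat (CARD('n) + 1)"
  define s' :: complex where "s' = of_nat (CARD('n) + 2)"
  have g: "g q has_fps_expansion R q" for q
    unfolding g_def R_def by (rule root_sum_has_fps_expansion)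
  have D1: "fps_deriv G = fps_const s * R 1"
    by (simp add: G_def R_def s_def fps_deriv_root_fps)
  have D2: "fps_deriv (fps_deriv G) = fps_const (s * s') * R 2"
    unfolding D1 by (simp add: R_def s'_def fps_deriv_root_fps fps_const_mult[symmetric] mult.assoc numeral_2_eq_2 del: fps_const_mult)
  have R0: "R 0 = G" by (simp add: R_def G_def)
  let ?f = "\<lambda>t. (s * g 1 t) ^ (CARD('n) - 1) *
      (g 0 t * (s * g 1 t) + t * (s * s' * g 2 t * g 0 t - (s * g 1 t)\<^sup>2))
      - s ^ CARD('n) * g 0 t ^ (CARD('n) + 2)"
  let ?F = "fps_deriv G ^ (CARD('n) - 1) *
        (G * fps_deriv G + fps_X * (fps_deriv (fps_deriv G) * G - (fps_deriv G)\<^sup>2))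
     - fps_const (s ^ CARD('n)) * G ^ (CARD('n) + 2)"
  have exp: "?f has_fps_expansion ?F"
    unfolding D2 unfolding D1 unfolding R0[symmetric]
    by (intro has_fps_expansion_diff has_fps_expansion_mult has_fps_expansion_power has_fps_expansion_add
        has_fps_expansion_fps_X has_fps_expansion_cmult_left has_fps_expansion_const g)
  have "eventually (\<lambda>t. \<forall>c\<in>Z. 1 - c * t \<noteq> 0) (nhds (0::complex))"
  proof (intro eventually_ball_finite ballI \<open>finite Z\<close>)
    fix c :: complex assume "c \<in> Z"
    have "((\<lambda>t. 1 - c * t) \<longlongrightarrow> 1 - c * 0) (nhds 0)"
      by (intro tendsto_intros filterlim_ident)
    then show "eventually (\<lambda>t. 1 - c * t \<noteq> 0) (nhds 0)"
      by (rule tendsto_imp_eventually_ne) simp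
  qed
  then have "eventually (\<lambda>t. ?f t = 0) (nhds 0)"
  proof eventually_elim
    case (elim t)
    then have *: "\<And>c. c \<in> Z \<Longrightarrow> 1 - c * t \<noteq> 0" by auto
    show ?case
      using vanish[OF F_group_scalar(1)[OF assms(1,2) *, where i = undefined]]
        F_group_scalar(2)[OF assms(1,2) *, where i = undefined]
      unfolding g_def s_def s'_def by simp
  qed
  with exp have "(\<lambda>_. 0) has_fps_expansion ?F"
    unfolding has_fps_expansion_def by (auto elim: eventually_elim2)
  then have "?F = 0"
    using fps_nth_fps_expansion[of "\<lambda>_. 0"] has_fps_expansion_0 by (metis fps_ext)
  then show ?thesis by (simp add: s_def)
qed

context
  fixes Z :: "complex set"
  assumes finite_Z: "finite Z" and one_Z: "1 \<in> Z" and zero_Z: "0 \<notin> Z"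
    and mult_Z: "\<And>c d. c \<in> Z \<Longrightarrow> d \<in> Z \<Longrightarrow> c * d \<in> Z"
begin

lemma mult_bij_betw: "c \<in> Z \<Longrightarrow> bij_betw ((*) c) Z Z"
  using finite_Z zero_Z mult_Z unfolding bij_betw_def
  by (intro conjI endo_inj_surj) (auto simp: inj_on_def)

lemma power_card_eq_1:
  assumes "c \<in> Z"
  shows "c ^ card Z = 1"
proof -
  have "(\<Prod>x\<in>Z. c * x) = (\<Prod>x\<in>Z. x)"
    by (rule prod.reindex_bij_betw[OF mult_bij_betw[OF assms]])
  then have "c ^ card Z * (\<Prod>x\<in>Z. x) = 1 * (\<Prod>x\<in>Z. x)"
    by (simp add: prod.distrib)
  moreover have "(\<Prod>x\<in>Z. x) \<noteq> 0" using finite_Z zero_Z by simp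
  ultimately show ?thesis by simp
qed

text \<open>
  Multiplication by any $c \in Z$ permutes $Z$, so the sum is invariant under the factor $c^m$.
\<close>

lemma power_sum: "(\<Sum>c\<in>Z. c ^ m) = (if \<forall>c\<in>Z. c ^ m = 1 then of_nat (card Z) else 0)"
proof (cases "\<forall>c\<in>Z. c ^ m = 1")
  case False
  then obtain c where c: "c \<in> Z" "c ^ m \<noteq> 1" by blast
  have "(\<Sum>x\<in>Z. (c * x) ^ m) = (\<Sum>x\<in>Z. x ^ m)"
    by (rule sum.reindex_bij_betw[OF mult_bij_betw[OF c(1)]])
  then have "c ^ m * (\<Sum>x\<in>Z. x ^ m) = 1 * (\<Sum>x\<in>Z. x ^ m)"
    by (simp add: power_mult_distrib sum_distrib_left)
  then show ?thesis using c(2) False by auto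
qed simp

lemma obtain_exponent:
  assumes "Z \<noteq> {1}"
  obtains e where "e \<ge> 2" "e \<le> card Z" "\<And>m. (\<forall>c\<in>Z. c ^ m = 1) \<longleftrightarrow> e dvd m"
proof -
  define P where "P m \<longleftrightarrow> m > 0 \<and> (\<forall>c\<in>Z. c ^ m = 1)" for m
  define e where "e = (LEAST m. P m)"
  have "P (card Z)"
    using power_card_eq_1 finite_Z one_Z by (auto simp: P_def card_gt_0_iff)
  then have Pe: "P e" and le: "e \<le> card Z" by (auto simp: e_def intro: LeastI Least_le)
  have "e \<noteq> 1" using Pe assms one_Z by (auto simp: P_def)
  moreover have "e > 0" using Pe by (simp add: P_def)
  ultimately have "e \<ge> 2" by simp
  moreover have "(\<forall>c\<in>Z. c ^ m = 1) \<longleftrightarrow> e dvd m" for m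
  proof
    assume m: "\<forall>c\<in>Z. c ^ m = 1"
    have "c ^ (m mod e) = 1" if "c \<in> Z" for c
    proof -
      have "c ^ m = (c ^ e) ^ (m div e) * c ^ (m mod e)"
        by (simp add: power_mult[symmetric] power_add[symmetric])
      then show ?thesis using m Pe that by (simp add: P_def)
    qed
    moreover have "\<not> P (m mod e)"
      using not_less_Least[of "m mod e" P] \<open>e > 0\<close> by (simp add: e_def[symmetric])
    ultimately show "e dvd m" by (auto simp: P_def dvd_eq_mod_eq_0)
  next
    assume "e dvd m"
    then show "\<forall>c\<in>Z. c ^ m = 1" using Pe by (auto simp: P_def power_mult elim!: dvdE)
  qed
  ultimately show ?thesis using that le by blast
qed

text \<open>
  Let $q$ be the order and $e$ the exponent of the group. The expansion of $\phi_\Gamma$ in $t = z^T w$ has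
  the coefficients $q \binom{N+i}{i}$ at the $i$ with $e \mid N + i$ and zero elsewhere. Let $k$ be the
  least such $i$. If $k = 0$, the equation fails in its constant term. Otherwise the two leading terms
  force $e = N + k$ and an equation that contradicts the binomial inequality, because $q \ge e$.
\<close>

lemma F_group_nonzero_if_all_scalar:
  assumes n2: "CARD('n::finite) \<ge> 2" and "Z \<noteq> {1}"
  shows "\<exists>p\<in>regular_points (mat ` Z :: (complex^'n^'n) set). F_group (mat ` Z) p \<noteq> 0"
proof (rule ccontr)
  assume "\<not> ?thesis"
  then have vanish: "\<And>p. p \<in> regular_points (mat ` Z :: (complex^'n^'n) set) \<Longrightarrow> F_group (mat ` Z) p = 0"
    by blast
  define n where "n = CARD('n)"
  define q where "q = card Z"
  define G where "G = root_fps Z n 0"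
  have n: "n \<ge> 2" using n2 by (simp add: n_def)
  note eq = root_fps_equation[OF n2 finite_Z vanish, folded n_def, folded G_def]
  obtain e where e: "e \<ge> 2" "e \<le> q" "\<And>m. (\<forall>c\<in>Z. c ^ m = 1) \<longleftrightarrow> e dvd m"
    unfolding q_def using obtain_exponent[OF \<open>Z \<noteq> {1}\<close>] by metis
  have G: "fps_nth G i = (if e dvd n + i then of_nat (((n + i) choose i) * q) else 0)" for i
    by (simp add: G_def nth_root_fps power_sum e(3) q_def)
  define k where "k = (LEAST k. e dvd n + k)"
  \<comment> \<open>A witness that some index qualifies, so that the least one exists.\<close>
  have "n + n * (e - 1) = e * n" using e(1) by (cases e) auto
  then have "e dvd n + n * (e - 1)" by simp
  then have k: "e dvd n + k" unfolding k_def by (rule LeastI)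
  have q: "q > 0" using e by simp
  have a: "fps_nth G k \<noteq> 0" and b: "fps_nth G (k + e) \<noteq> 0"
    using k q by (simp_all only: G add.assoc[symmetric] dvd_add_triv_right_iff if_True of_nat_eq_0_iff) simp_all
  have gap: "fps_nth G i = 0" if "i < k + e" "i \<noteq> k" for i
  proof -
    have "\<not> e dvd n + i"
    proof
      assume dvd: "e dvd n + i"
      then have "k \<le> i" unfolding k_def by (rule Least_le)
      then have "e dvd i - k" using dvd_diff_nat[OF dvd k] by simp
      then show False using that \<open>k \<le> i\<close> by (auto dest!: dvd_imp_le)
    qed
    then show ?thesis by (simp add: G)
  qed
  let ?C = "of_nat (n + 1) ^ n :: complex"
  have C: "?C \<noteq> 0" by (simp del: of_nat_add of_nat_Suc)
  show False
  proof (cases "k = 0")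
    case True
    have "fps_nth G 1 = 0" using True e(1) by (intro gap) auto
    then have "fps_nth (fps_deriv G) 0 = 0" by simp
    then have "?C * fps_nth G 0 ^ (n + 2) = 0"
      using arg_cong[OF eq, of "\<lambda>F. fps_nth F 0"]
      by (simp add: fps_power_zeroth)
    then show False using a C True by simp
  next
    case False
    have *: "e = n + k \<and> of_nat k ^ (n - 1) * fps_nth G (k + e) * of_nat e ^ 2 = ?C * fps_nth G k ^ 2"
      using n False e(1) by (intro fps_leading_terms a b C gap eq) auto
    then have en: "e = n + k" by simp
    have c1: "(n + k) choose k = e choose n"
      unfolding en by (subst binomial_symmetric) simp_all
    have c2: "(n + (k + e)) choose (k + e) = (2 * e) choose n"
      unfolding en by (subst binomial_symmetric) (simp_all add: mult_2 add_ac)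
    have Gk: "fps_nth G k = of_nat ((e choose n) * q)"
      using k by (simp add: G c1)
    have "e dvd n + (k + e)" using k by (simp add: add.assoc[symmetric])
    then have Gke: "fps_nth G (k + e) = of_nat (((2 * e) choose n) * q)"
      by (simp only: G c2 if_True)
    have "of_nat (k ^ (n - 1) * (((2 * e) choose n) * q) * e ^ 2) = (of_nat ((n + 1) ^ n * ((e choose n) * q) ^ 2) :: complex)"
      using conjunct2[OF *] by (simp only: Gk Gke of_nat_mult of_nat_power)
    then have "k ^ (n - 1) * (((2 * e) choose n) * q) * e ^ 2 = (n + 1) ^ n * ((e choose n) * q) ^ 2"
      by (simp only: of_nat_eq_iff)
    then have "(k ^ (n - 1) * e * ((2 * e) choose n)) * e * q = ((n + 1) ^ n * (e choose n) ^ 2 * q) * q"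
      by (simp add: power2_eq_square mult_ac)
    then have "(k ^ (n - 1) * e * ((2 * e) choose n)) * e = (n + 1) ^ n * (e choose n) ^ 2 * q"
      using q by simp
    moreover have less: "k ^ (n - 1) * e * ((2 * e) choose n) < (n + 1) ^ n * (e choose n) ^ 2"
      using binomial_inequality[OF n, of k] False unfolding en by simp
    have "(k ^ (n - 1) * e * ((2 * e) choose n)) * e < (n + 1) ^ n * (e choose n) ^ 2 * q"
      by (rule mult_less_le_imp_less[OF less e(2)]) (use e(1) in simp_all)
    ultimately show False by simp
  qed
qed

end

section \<open>Nontrivial fixed-point-free groups\<close>

theorem theorem2p2:
  fixes \<Gamma> :: "(complex^'n^'n) set"
  assumes "CARD('n) \<ge> 2"
    and "subgroup \<Gamma> unitary_group"
    and "finite \<Gamma>"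
    and "\<Gamma> \<noteq> {mat 1}"
    and "fixed_point_free \<Gamma>"
  shows "\<not> (\<forall>p \<in> regular_points \<Gamma>. F_group \<Gamma> p = 0)"
proof -
  have one: "mat 1 \<in> \<Gamma>" and unitary: "\<And>\<delta>. \<delta> \<in> \<Gamma> \<Longrightarrow> unitary_matrix \<delta>"
    and mult: "\<And>\<gamma> \<delta>. \<gamma> \<in> \<Gamma> \<Longrightarrow> \<delta> \<in> \<Gamma> \<Longrightarrow> \<gamma> ** \<delta> \<in> \<Gamma>"
    using subgroup.one_closed[OF assms(2)] subgroup.subset[OF assms(2)] subgroup.m_closed[OF assms(2)]
    by (auto simp: unitary_group_def)
  have "\<exists>p\<in>regular_points \<Gamma>. F_group \<Gamma> p \<noteq> 0"
  proof (cases "\<exists>\<gamma>\<in>\<Gamma>. \<forall>a. \<gamma> \<noteq> mat a")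
    case True
    then obtain \<gamma> where "\<gamma> \<in> \<Gamma>" "\<And>a. \<gamma> \<noteq> mat a" by blast
    then show ?thesis
      using F_group_nonzero_if_nonscalar_element[OF assms(3) one unitary assms(5)] by blast
  next
    case False
    define Z where "Z = {a. mat a \<in> \<Gamma>}"
    have \<Gamma>: "\<Gamma> = mat ` Z" using False by (auto simp: Z_def)
    have "finite (mat ` Z :: (complex^'n^'n) set)" using assms(3) \<Gamma> by simp
    then have "finite Z" by (rule finite_imageD) (rule inj_on_subset[OF inj_mat], simp)
    moreover have "1 \<in> Z" using one by (simp add: Z_def)
    moreover have "0 \<notin> Z"
    proof
      assume "0 \<in> Z"
      then have "unitary_matrix (mat 0 :: complex^'n^'n)" using unitary by (simp add: Z_def)
      then have "mat 0 = (mat 1 :: complex^'n^'n)" by (simp add: unitary_matrix_def)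
      then show False by (metis injD inj_mat zero_neq_one)
    qed
    moreover have "c * d \<in> Z" if "c \<in> Z" "d \<in> Z" for c d
    proof -
      have "mat c ** mat d = (mat (c * d) :: complex^'n^'n)"
        by (rule matrix_eqI_vec) (simp add: matrix_vector_mul_assoc[symmetric])
      with mult[of "mat c" "mat d"] that show ?thesis unfolding Z_def mem_Collect_eq by metis
    qed
    moreover have "Z \<noteq> {1}"
    proof
      assume "Z = {1}"
      with \<Gamma> have "\<Gamma> = {mat 1}" by simp
      with assms(4) show False by contradiction
    qed
    ultimately show ?thesis unfolding \<Gamma> using assms(1) by (intro F_group_nonzero_if_all_scalar) assumption+
  qed
  then show ?thesis by blast
qed

end
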